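(* Let $\mathcal H$ and $\mathcal K$ be separable complex Krein spaces, $A\in L(\mathcal K,\mathcal H)$ and $W\in S_1\cap L(\mathcal H)^s$, i.e. $W\in L(\mathcal H)$ is trace class and $W=W^{\#}$. Then the following statements are equivalent: (i) the equation $Az=x$ admits a $W$-ILSS for every $x\in\mathcal H$; (ii) $A$ admits an indefinite $W$-inverse, i.e., there is $G\in L(\mathcal H,\mathcal K)$ such that for every $x\in\mathcal H$, $Gx$ is a $W$-ILSS of $Az=x$; (iii) $\operatorname{ran}A$ is $W$-nonnegative and there exists $$\min_{X\in L(\mathcal H,\mathcal K)}\operatorname{tr}_J\big((AX-I)^{\#}W(AX-I)\big)$$ for every signature operator $J$ of $\mathcal H$.
   Context: A Krein space is a complex vector space with an indefinite inner product $[\cdot,\cdot]$ admitting a $[\cdot,\cdot]$-orthogonal direct sum decomposition (fundamental decomposition) $\mathcal H=\mathcal H_+[\dotplus]\mathcal H_-$ with $(\mathcal H_+,[\cdot,\cdot])$ and $(\mathcal H_-,-[\cdot,\cdot])$ Hilbert spaces. The associated signature operator is $J=P_+-P_-$, where $P_\pm$ is the projection onto $\mathcal H_\pm$ along $\mathcal H_\mp$, and $\langle x,y\rangle_J=[Jx,y]$ is a Hilbert space inner product; all such inner products give equivalent norms. $L(\mathcal K,\mathcal H)$ is the set of linear operators $\mathcal K\to\mathcal H$ bounded with respect to these norms, $L(\mathcal H)=L(\mathcal H,\mathcal H)$. For an operator $T$, $T^{\#}$ denotes its adjoint with respect to the indefinite inner products, and $L(\mathcal H)^s=\{T\in L(\mathcal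 H):T=T^{\#}\}$. $S_1$ denotes the trace class operators in $L(\mathcal H)$ with respect to $\langle\cdot,\cdot\rangle_J$; the class does not depend on $J$. For $T\in S_1$ the $J$-trace is $\operatorname{tr}_J(T)=\sum_n[Te_n,e_n]=\operatorname{tr}(JT)$, where $\{e_n\}$ is any orthonormal basis of $(\mathcal H,\langle\cdot,\cdot\rangle_J)$. A subspace $\mathcal S$ is $W$-nonnegative if $[Ws,s]\ge0$ for every $s\in\mathcal S$. Given $x\in\mathcal H$, a $W$-ILSS of $Az=x$ is a vector $u\in\mathcal K$ such that $[W(Au-x),Au-x]\le[W(Az-x),Az-x]$ for every $z\in\mathcal K$. The range of $A$ is not assumed to be closed. *)

theory Defs
  imports "HOL-Analysis.Analysis" "HOL-Library.Complex_Order"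
begin

text \<open>
  All spaces are carried by a whole type, with an explicit complex scalar multiplication. Forms are
  linear in the first argument. The order on the complex numbers is the one of
  \<^theory>\<open>HOL-Library.Complex_Order\<close>: \<open>z \<le> w\<close> means that \<open>w - z\<close> is a nonnegative real number.
\<close>

section \<open>Hilbert spaces and trace class operators\<close>

locale hermitian_space = vector_space scl
  for scl :: "complex \<Rightarrow> 'a::ab_group_add \<Rightarrow> 'a" +
  fixes ip :: "'a \<Rightarrow> 'a \<Rightarrow> complex"
  assumes ip_add_left: "ip (x + y) z = ip x z + ip y z"
    and ip_scale_left: "ip (scl c x) y = c * ip x y"
    and ip_commute: "ip x y = cnj (ip y x)"

text \<open>
  The modulus makes the induced distance nonnegative and symmetric on the whole type, as
  \<^locale>\<open>Metric_space\<close> demands, even if the form is positive definite only on a subspace.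
\<close>

definition form_norm :: "('a \<Rightarrow> 'a \<Rightarrow> complex) \<Rightarrow> 'a \<Rightarrow> real" where
  "form_norm g x = sqrt (cmod (g x x))"

definition form_dist :: "('a::ab_group_add \<Rightarrow> 'a \<Rightarrow> complex) \<Rightarrow> 'a \<Rightarrow> 'a \<Rightarrow> real" where
  "form_dist g x y = form_norm g (x - y)"

definition hilbert_on ::
  "(complex \<Rightarrow> 'a \<Rightarrow> 'a) \<Rightarrow> ('a::ab_group_add \<Rightarrow> 'a \<Rightarrow> complex) \<Rightarrow> 'a set \<Rightarrow> bool" where
  "hilbert_on scl g M \<longleftrightarrow>
     hermitian_space scl g \<and> module.subspace scl M \<and>
     (\<forall>x\<in>M. x \<noteq> 0 \<longrightarrow> 0 < g x x) \<and> Metric_space.mcomplete M (form_dist g)"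

definition bounded_op ::
  "(complex \<Rightarrow> 'a \<Rightarrow> 'a) \<Rightarrow> ('a::ab_group_add \<Rightarrow> 'a \<Rightarrow> complex) \<Rightarrow>
   (complex \<Rightarrow> 'b \<Rightarrow> 'b) \<Rightarrow> ('b::ab_group_add \<Rightarrow> 'b \<Rightarrow> complex) \<Rightarrow> ('a \<Rightarrow> 'b) \<Rightarrow> bool" where
  "bounded_op scl1 g1 scl2 g2 T \<longleftrightarrow>
     Vector_Spaces.linear scl1 scl2 T \<and>
     (\<exists>C. \<forall>x. form_norm g2 (T x) \<le> C * form_norm g1 x)"

text \<open>
  The adjoint with respect to two forms: the Krein space adjoint if the forms are indefinite inner
  products, the Hilbert space adjoint if they are Hilbert space inner products.
\<close>

definition form_adjoint ::
  "('a \<Rightarrow> 'a \<Rightarrow> complex) \<Rightarrow> ('b \<Rightarrow> 'b \<Rightarrow> complex) \<Rightarrow> ('a \<Rightarrow> 'b) \<Rightarrow> 'b \<Rightarrow> 'a" where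
  "form_adjoint g1 g2 T = (THE S. \<forall>x y. g2 (T x) y = g1 x (S y))"

definition orthonormal_basis :: "('a::zero \<Rightarrow> 'a \<Rightarrow> complex) \<Rightarrow> 'a set \<Rightarrow> bool" where
  "orthonormal_basis g E \<longleftrightarrow>
     (\<forall>e\<in>E. \<forall>f\<in>E. g e f = (if e = f then 1 else 0)) \<and>
     (\<forall>x. (\<forall>e\<in>E. g x e = 0) \<longrightarrow> x = 0)"

text \<open>\<open>R\<close> is the absolute value of \<open>T\<close>, the positive square root of \<open>T\<^sup>* T\<close>.\<close>

definition is_absolute_value ::
  "(complex \<Rightarrow> 'a \<Rightarrow> 'a) \<Rightarrow> ('a::ab_group_add \<Rightarrow> 'a \<Rightarrow> complex) \<Rightarrow> ('a \<Rightarrow> 'a) \<Rightarrow> ('a \<Rightarrow> 'a) \<Rightarrow> bool" where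
  "is_absolute_value scl g T R \<longleftrightarrow>
     bounded_op scl g scl g R \<and> (\<forall>x. 0 \<le> g (R x) x) \<and> R \<circ> R = form_adjoint g g T \<circ> T"

definition trace_class ::
  "(complex \<Rightarrow> 'a \<Rightarrow> 'a) \<Rightarrow> ('a::ab_group_add \<Rightarrow> 'a \<Rightarrow> complex) \<Rightarrow> ('a \<Rightarrow> 'a) \<Rightarrow> bool" where
  "trace_class scl g T \<longleftrightarrow>
     bounded_op scl g scl g T \<and>
     (\<exists>R E. is_absolute_value scl g T R \<and> orthonormal_basis g E \<and>
            (\<lambda>e. g (R e) e) summable_on E)"

section \<open>Krein spaces\<close>

definition fundamental_decomposition ::
  "(complex \<Rightarrow> 'a \<Rightarrow> 'a) \<Rightarrow> ('a::ab_group_add \<Rightarrow> 'a \<Rightarrow> complex) \<Rightarrow> 'a set \<Rightarrow> 'a set \<Rightarrow> bool" where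
  "fundamental_decomposition scl ip Hp Hm \<longleftrightarrow>
     hilbert_on scl ip Hp \<and> hilbert_on scl (\<lambda>x y. - ip x y) Hm \<and>
     (\<forall>u\<in>Hp. \<forall>v\<in>Hm. ip u v = 0) \<and>
     Hp \<inter> Hm = {0} \<and> (\<forall>x. \<exists>u\<in>Hp. \<exists>v\<in>Hm. x = u + v)"

locale krein_space = hermitian_space scl ip
  for scl :: "complex \<Rightarrow> 'a::ab_group_add \<Rightarrow> 'a" and ip :: "'a \<Rightarrow> 'a \<Rightarrow> complex" +
  assumes ex_fundamental_decomposition: "\<exists>Hp Hm. fundamental_decomposition scl ip Hp Hm"

definition signature_operator ::
  "(complex \<Rightarrow> 'a \<Rightarrow> 'a) \<Rightarrow> ('a::ab_group_add \<Rightarrow> 'a \<Rightarrow> complex) \<Rightarrow> ('a \<Rightarrow> 'a) \<Rightarrow> bool" where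
  "signature_operator scl ip J \<longleftrightarrow>
     (\<exists>Hp Hm. fundamental_decomposition scl ip Hp Hm \<and>
              (\<forall>u\<in>Hp. \<forall>v\<in>Hm. J (u + v) = u - v))"

definition signature_ip :: "('a \<Rightarrow> 'a \<Rightarrow> complex) \<Rightarrow> ('a \<Rightarrow> 'a) \<Rightarrow> 'a \<Rightarrow> 'a \<Rightarrow> complex" where
  "signature_ip ip J x y = ip (J x) y"

text \<open>
  The norms induced by different signature operators are equivalent. Hence in each of the next three
  definitions it does not matter whether the signature operators are quantified existentially or
  universally.
\<close>

definition krein_separable ::
  "(complex \<Rightarrow> 'a \<Rightarrow> 'a) \<Rightarrow> ('a::ab_group_add \<Rightarrow> 'a \<Rightarrow> complex) \<Rightarrow> bool" where
  "krein_separable scl ip \<longleftrightarrow>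
     (\<exists>J. signature_operator scl ip J \<and>
          separable_space (Metric_space.mtopology UNIV (form_dist (signature_ip ip J))))"

definition krein_operators ::
  "(complex \<Rightarrow> 'a \<Rightarrow> 'a) \<Rightarrow> ('a::ab_group_add \<Rightarrow> 'a \<Rightarrow> complex) \<Rightarrow>
   (complex \<Rightarrow> 'b \<Rightarrow> 'b) \<Rightarrow> ('b::ab_group_add \<Rightarrow> 'b \<Rightarrow> complex) \<Rightarrow> ('a \<Rightarrow> 'b) set" where
  "krein_operators scl1 ip1 scl2 ip2 =
     {T. \<exists>J1 J2. signature_operator scl1 ip1 J1 \<and> signature_operator scl2 ip2 J2 \<and>
                 bounded_op scl1 (signature_ip ip1 J1) scl2 (signature_ip ip2 J2) T}"

definition krein_trace_class ::
  "(complex \<Rightarrow> 'a \<Rightarrow> 'a) \<Rightarrow> ('a::ab_group_add \<Rightarrow> 'a \<Rightarrow> complex) \<Rightarrow> ('a \<Rightarrow> 'a) set" where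
  "krein_trace_class scl ip =
     {T. \<exists>J. signature_operator scl ip J \<and> trace_class scl (signature_ip ip J) T}"

definition krein_selfadjoint ::
  "(complex \<Rightarrow> 'a \<Rightarrow> 'a) \<Rightarrow> ('a::ab_group_add \<Rightarrow> 'a \<Rightarrow> complex) \<Rightarrow> ('a \<Rightarrow> 'a) set" where
  "krein_selfadjoint scl ip =
     {T \<in> krein_operators scl ip scl ip. T = form_adjoint ip ip T}"

text \<open>Only meaningful for trace class \<open>T\<close>; the value is common to all orthonormal bases.\<close>

definition J_trace ::
  "('a::zero \<Rightarrow> 'a \<Rightarrow> complex) \<Rightarrow> ('a \<Rightarrow> 'a) \<Rightarrow> ('a \<Rightarrow> 'a) \<Rightarrow> complex" where
  "J_trace ip J T =
     (THE t. \<forall>E. orthonormal_basis (signature_ip ip J) E \<longrightarrow> ((\<lambda>e. ip (T e) e) has_sum t) E)"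

section \<open>Indefinite least squares problems\<close>

definition W_nonnegative :: "('a \<Rightarrow> 'a \<Rightarrow> complex) \<Rightarrow> ('a \<Rightarrow> 'a) \<Rightarrow> 'a set \<Rightarrow> bool" where
  "W_nonnegative ip W S \<longleftrightarrow> (\<forall>s\<in>S. 0 \<le> ip (W s) s)"

definition W_ILSS ::
  "('b::ab_group_add \<Rightarrow> 'b \<Rightarrow> complex) \<Rightarrow> ('b \<Rightarrow> 'b) \<Rightarrow> ('a \<Rightarrow> 'b) \<Rightarrow> 'b \<Rightarrow> 'a \<Rightarrow> bool" where
  "W_ILSS ip W A x u \<longleftrightarrow>
     (\<forall>z. ip (W (A u - x)) (A u - x) \<le> ip (W (A z - x)) (A z - x))"

definition indefinite_W_inverse ::
  "(complex \<Rightarrow> 'a \<Rightarrow> 'a) \<Rightarrow> ('a::ab_group_add \<Rightarrow> 'a \<Rightarrow> complex) \<Rightarrow>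
   (complex \<Rightarrow> 'b \<Rightarrow> 'b) \<Rightarrow> ('b::ab_group_add \<Rightarrow> 'b \<Rightarrow> complex) \<Rightarrow>
   ('b \<Rightarrow> 'b) \<Rightarrow> ('a \<Rightarrow> 'b) \<Rightarrow> ('b \<Rightarrow> 'a) \<Rightarrow> bool" where
  "indefinite_W_inverse sclK ipK sclH ipH W A G \<longleftrightarrow>
     G \<in> krein_operators sclH ipH sclK ipK \<and> (\<forall>x. W_ILSS ipH W A x (G x))"

text \<open>The operator \<open>(A X - I)\<^sup># W (A X - I)\<close>.\<close>

definition residual_operator ::
  "('b::ab_group_add \<Rightarrow> 'b \<Rightarrow> complex) \<Rightarrow> ('b \<Rightarrow> 'b) \<Rightarrow> ('a \<Rightarrow> 'b) \<Rightarrow> ('b \<Rightarrow> 'a) \<Rightarrow> 'b \<Rightarrow> 'b" where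
  "residual_operator ip W A X =
     form_adjoint ip ip (\<lambda>h. A (X h) - h) \<circ> W \<circ> (\<lambda>h. A (X h) - h)"

end

theory Submission
  imports Defs
begin

text \<open>
  Put \<open>q(x, y) = [W x, y]\<close>. A vector \<open>u\<close> is a \<open>W\<close>-ILSS of \<open>A z = x\<close> iff \<open>q\<close> is nonnegative on the
  range of \<open>A\<close> and the normal equations \<open>q(A u - x, A z) = 0\<close> hold for all \<open>z\<close>.

  If the normal equations are solvable for every \<open>x\<close>, write \<open>q(A u, A z) = \<langle>u, M z\<rangle>\<close> and let \<open>G x\<close> be the
  solution in the closure of the range of \<open>M\<close>; it is linear in \<open>x\<close>, and bounded by the uniform
  boundedness principle. A pointwise minimal \<open>G\<close> minimizes every trace termwise, and a minimizer of
  one trace solves the normal equations, as rank one perturbations show.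

  The traces exist and do not depend on the basis since \<open>q\<close> is a difference of positive forms of
  finite trace, each of which is a sum \<open>\<Sum>n. \<bar>\<phi> n x\<bar>\<^sup>2\<close> over bounded functionals with square
  summable norms. The \<open>\<phi> n\<close> come from a Cholesky decomposition along a dense sequence, which replaces
  square roots of operators; that the forms are positive rests on \<open>\<bar>\<langle>T x, x\<rangle>\<bar> \<le> \<langle>R x, x\<rangle>\<close> for
  symmetric \<open>T\<close> with absolute value \<open>R\<close>.
\<close>

section \<open>Hermitian forms\<close>

text \<open>Neither the range of \<open>A\<close> nor that of \<open>M\<close> has to be closed, so
  a bounded \<open>G\<close> cannot be had by inverting an operator on a closed range. Pointwise
  solvability itself supplies the bound: writing
  \<open>q(x, A z) = \<langle>x, N z\<rangle>\<close>, it makes the vectors \<open>N z\<close> with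
  \<open>M z\<close> in the unit ball weakly bounded. For the traces, the hypothesis gives a finite
  trace for one signature operator and one basis, whereas (iii) speaks of all signature operators
  and of \<open>J_trace\<close>, a definite description that denotes nothing useful before existence
  and basis independence are known. Bounded functionals are the right intermediate object: they
  remain bounded functionals under a change of signature norm and under composition with a bounded
  operator, and by Riesz and Parseval the sum of the squares of a functional over a basis is a
  squared norm that does not see the basis.\<close>

context hermitian_space
begin

lemma ip_add_right: "ip x (y + z) = ip x y + ip x z"
  by (metis complex_cnj_add ip_add_left ip_commute)

lemma ip_scale_right: "ip x (scl c y) = cnj c * ip x y"
  by (metis complex_cnj_mult ip_scale_left ip_commute)

lemma ip_zero_left [simp]: "ip 0 x = 0"
  using ip_add_left[of 0 0 x] by simp

lemma ip_zero_right [simp]: "ip x 0 = 0"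
  using ip_add_right[of x 0 0] by simp

lemma ip_minus_left: "ip (- x) y = - ip x y"
  using ip_add_left[of x "- x" y] by (simp add: add_eq_0_iff)

lemma ip_minus_right: "ip x (- y) = - ip x y"
  using ip_add_right[of x y "- y"] by (simp add: add_eq_0_iff)

lemma ip_diff_left: "ip (x - y) z = ip x z - ip y z"
  using ip_add_left[of x "- y" z] by (simp add: ip_minus_left)

lemma ip_diff_right: "ip x (y - z) = ip x y - ip x z"
  using ip_add_right[of x y "- z"] by (simp add: ip_minus_right)

lemma ip_sum_left: "ip (\<Sum>i\<in>F. f i) y = (\<Sum>i\<in>F. ip (f i) y)"
  by (induction F rule: infinite_finite_induct) (auto simp: ip_add_left)

lemma ip_sum_right: "ip x (\<Sum>i\<in>F. f i) = (\<Sum>i\<in>F. ip x (f i))"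
  by (induction F rule: infinite_finite_induct) (auto simp: ip_add_right)

lemmas ip_simps = ip_add_left ip_add_right ip_scale_left ip_scale_right ip_minus_left
  ip_minus_right ip_diff_left ip_diff_right

lemma Im_ip_self [simp]: "Im (ip x x) = 0"
  by (metis complex_In_mult_cnj_zero Reals_cnj_iff complex_is_Real_iff ip_commute)

lemma ip_self: "ip x x = of_real (Re (ip x x))"
  by (simp add: complex_eq_iff)

lemma Re_ip_commute: "Re (ip x y) = Re (ip y x)"
  by (metis cnj.sel(1) ip_commute)

lemma cmod_ip_commute: "cmod (ip x y) = cmod (ip y x)"
  by (metis complex_mod_cnj ip_commute)

lemma ip_self_add: "Re (ip (x + y) (x + y)) = Re (ip x x) + 2 * Re (ip x y) + Re (ip y y)"
  by (simp add: ip_simps Re_ip_commute[of y x])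

lemma ip_self_diff: "Re (ip (x - y) (x - y)) = Re (ip x x) - 2 * Re (ip x y) + Re (ip y y)"
  by (simp add: ip_simps Re_ip_commute[of y x])

lemma ip_self_scale: "Re (ip (scl c x) (scl c x)) = (cmod c)\<^sup>2 * Re (ip x x)"
proof -
  have "ip (scl c x) (scl c x) = (c * cnj c) * ip x x"
    by (simp add: ip_simps)
  then show ?thesis
    by (simp add: complex_norm_square[symmetric] del: of_real_power)
qed

text \<open>Positivity is asked on \<open>M\<close> only and may be degenerate, so that the
  inequality serves a summand of an indefinite form as well as semidefinite remainders and
  differences of forms.\<close>

lemma Cauchy_Schwarz_on:
  assumes M: "subspace M" and pos: "\<And>x. x \<in> M \<Longrightarrow> 0 \<le> Re (ip x x)"
    and x: "x \<in> M" and y: "y \<in> M"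
  shows "(cmod (ip x y))\<^sup>2 \<le> Re (ip x x) * Re (ip y y)"
proof -
  define a b d where "a = Re (ip x x)" and "b = (cmod (ip x y))\<^sup>2" and "d = Re (ip y y)"
  \<comment> \<open>Moving along a real multiple \<open>t\<close> of \<open>ip x y\<close> makes the
    cross term the real number \<open>t * b\<close>, so one real parameter suffices.\<close>
  have q: "0 \<le> a - 2 * t * b + t\<^sup>2 * b * d" for t :: real
  proof -
    define c where "c = of_real t * ip x y"
    have "x - scl c y \<in> M"
      using M x y by (simp add: subspace_diff subspace_scale)
    then have "0 \<le> Re (ip (x - scl c y) (x - scl c y))" by (rule pos)
    also have "\<dots> = a - 2 * Re (ip x (scl c y)) + (cmod c)\<^sup>2 * d"
      by (simp add: ip_self_diff ip_self_scale a_def d_def)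
    also have "ip x (scl c y) = of_real (t * b)"
      by (simp add: ip_scale_right c_def b_def complex_norm_square mult.commute mult.left_commute
          del: of_real_power)
    also have "(cmod c)\<^sup>2 = t\<^sup>2 * b"
      by (simp add: c_def b_def norm_mult power_mult_distrib)
    finally show ?thesis by simp
  qed
  have "d \<ge> 0" using pos[OF y] by (simp add: d_def)
  show ?thesis
  proof (cases "d = 0")
    case True
    have "b \<ge> 0" by (simp add: b_def)
    have "b = 0"
    proof (rule ccontr)
      assume "b \<noteq> 0"
      then have "a - 2 * ((a + 1) / b) * b = - a - 2" by (simp add: field_simps)
      moreover have "a \<ge> 0" using pos[OF x] by (simp add: a_def)
      ultimately show False using q[of "(a + 1) / b"] True by simp
    qed
    then show ?thesis using True by (simp add: a_def b_def d_def)
  next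
    case False
    with \<open>d \<ge> 0\<close> have "d > 0" by simp
    have "0 \<le> a - 2 * (1 / d) * b + (1 / d)\<^sup>2 * b * d" by (rule q)
    also have "\<dots> = a - b / d" using \<open>d > 0\<close> by (simp add: field_simps power2_eq_square)
    finally have "b \<le> a * d" using \<open>d > 0\<close> by (simp add: field_simps)
    then show ?thesis by (simp add: a_def b_def d_def)
  qed
qed

lemma form_norm_nonneg [simp]: "0 \<le> form_norm ip x"
  by (simp add: form_norm_def)

lemma form_norm_zero [simp]: "form_norm ip 0 = 0"
  by (simp add: form_norm_def)

lemma form_norm_scale: "form_norm ip (scl c x) = cmod c * form_norm ip x"
proof -
  have "cmod (ip (scl c x) (scl c x)) = (cmod c)\<^sup>2 * cmod (ip x x)"
    by (simp add: ip_simps norm_mult power2_eq_square)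
  then show ?thesis by (simp add: form_norm_def real_sqrt_mult)
qed

lemma form_norm_minus: "form_norm ip (- x) = form_norm ip x"
  by (simp add: form_norm_def ip_simps)

lemma form_norm_minus_commute: "form_norm ip (x - y) = form_norm ip (y - x)"
  using form_norm_minus[of "x - y"] by simp

lemma form_norm_square: "0 \<le> Re (ip x x) \<Longrightarrow> (form_norm ip x)\<^sup>2 = Re (ip x x)"
  by (subst ip_self) (simp add: form_norm_def cmod_def)

context
  fixes M
  assumes M: "subspace M" and pos: "\<And>x. x \<in> M \<Longrightarrow> 0 \<le> Re (ip x x)"
begin

lemma cmod_ip_le_on: "x \<in> M \<Longrightarrow> y \<in> M \<Longrightarrow> cmod (ip x y) \<le> form_norm ip x * form_norm ip y"
  by (rule power2_le_imp_le)
    (simp_all add: power_mult_distrib form_norm_square pos Cauchy_Schwarz_on[OF M pos])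

lemma form_norm_triangle_on:
  assumes x: "x \<in> M" and y: "y \<in> M"
  shows "form_norm ip (x + y) \<le> form_norm ip x + form_norm ip y"
proof (rule power2_le_imp_le)
  have "x + y \<in> M" using M x y by (simp add: subspace_add)
  have "Re (ip x y) \<le> form_norm ip x * form_norm ip y"
    using cmod_ip_le_on[OF x y] complex_Re_le_cmod order_trans by blast
  then show "(form_norm ip (x + y))\<^sup>2 \<le> (form_norm ip x + form_norm ip y)\<^sup>2"
    using form_norm_square[OF pos[OF \<open>x + y \<in> M\<close>]] form_norm_square[OF pos[OF x]]
      form_norm_square[OF pos[OF y]] ip_self_add[of x y]
    by (simp add: power2_sum)
qed simp

end

end

lemma hilbert_on_Metric_space:
  assumes "hilbert_on scl g M"
  shows "Metric_space M (form_dist g)"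
proof -
  interpret hermitian_space scl g using assms by (simp add: hilbert_on_def)
  have M: "subspace M" and pos: "\<And>x. x \<in> M \<Longrightarrow> x \<noteq> 0 \<Longrightarrow> 0 < Re (g x x)"
    using assms by (auto simp: hilbert_on_def less_complex_def)
  have nn: "0 \<le> Re (g x x)" if "x \<in> M" for x
    using pos[OF that] by (cases "x = 0") auto
  show ?thesis
  proof
    fix x y assume "x \<in> M" "y \<in> M"
    then have "x - y \<in> M" using M by (simp add: subspace_diff)
    then have "form_norm g (x - y) = 0 \<Longrightarrow> x - y = 0"
      using form_norm_square[OF nn[of "x - y"]] pos[of "x - y"] by (cases "x - y = 0") auto
    then show "form_dist g x y = 0 \<longleftrightarrow> x = y" by (auto simp: form_dist_def)
  next
    fix x y z assume "x \<in> M" "y \<in> M" "z \<in> M"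
    then have "x - y \<in> M" "y - z \<in> M" using M by (simp_all add: subspace_diff)
    from form_norm_triangle_on[OF M nn this]
    show "form_dist g x z \<le> form_dist g x y + form_dist g y z"
      by (simp add: form_dist_def)
  qed (simp_all add: form_dist_def form_norm_minus_commute)
qed

text \<open>The only passage through \<open>mcomplete\<close>; from here on completeness is a
  statement about Cauchy sequences in \<open>form_norm\<close>.\<close>

lemma hilbert_on_complete:
  assumes H: "hilbert_on scl g M" and X: "\<And>n. X n \<in> M"
    and C: "\<And>e. e > 0 \<Longrightarrow> \<exists>N. \<forall>m\<ge>N. \<forall>n\<ge>N. form_norm g (X m - X n) < e"
  shows "\<exists>l\<in>M. (\<lambda>n. form_norm g (X n - l)) \<longlonglongrightarrow> 0"
proof -
  interpret Metric_space M "form_dist g" by (rule hilbert_on_Metric_space[OF H])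
  have "MCauchy X" using X C by (auto simp: MCauchy_def form_dist_def)
  moreover have mcomplete using H by (simp add: hilbert_on_def)
  ultimately obtain l where "limitin mtopology X l sequentially"
    unfolding mcomplete_def by blast
  then show ?thesis
    by (auto simp: limitin_metric_dist_null form_dist_def)
qed

section \<open>Hilbert spaces\<close>

definition functional :: "(complex \<Rightarrow> 'a \<Rightarrow> 'a) \<Rightarrow> ('a::ab_group_add \<Rightarrow> complex) \<Rightarrow> bool" where
  "functional scl \<phi> \<longleftrightarrow>
     (\<forall>x y. \<phi> (x + y) = \<phi> x + \<phi> y) \<and> (\<forall>c x. \<phi> (scl c x) = c * \<phi> x)"

locale hilbert_space = hermitian_space scl g
  for scl :: "complex \<Rightarrow> 'a::ab_group_add \<Rightarrow> 'a" and g :: "'a \<Rightarrow> 'a \<Rightarrow> complex" +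
  assumes pos: "x \<noteq> 0 \<Longrightarrow> 0 < Re (g x x)"
    and complete: "(\<And>e. e > 0 \<Longrightarrow> \<exists>N. \<forall>m\<ge>N. \<forall>n\<ge>N. form_norm g (X m - X n) < e) \<Longrightarrow>
      \<exists>l. (\<lambda>n. form_norm g (X n - l)) \<longlonglongrightarrow> 0"
begin

abbreviation nrm :: "'a \<Rightarrow> real" where "nrm \<equiv> form_norm g"

lemma nonneg [simp]: "0 \<le> Re (g x x)"
  using pos[of x] by (cases "x = 0") auto

lemma nrm_square: "(nrm x)\<^sup>2 = Re (g x x)"
  by (simp add: form_norm_square)

lemma ip_self_nrm: "g x x = of_real ((nrm x)\<^sup>2)"
  by (simp add: nrm_square complex_eq_iff del: of_real_power)

lemma nrm_eq_0_iff [simp]: "nrm x = 0 \<longleftrightarrow> x = 0"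
proof
  assume "nrm x = 0"
  then show "x = 0" using nrm_square[of x] pos[of x] by (cases "x = 0") auto
qed simp

lemma nrm_pos: "x \<noteq> 0 \<Longrightarrow> 0 < nrm x"
  by (metis form_norm_nonneg nrm_eq_0_iff order_le_less)

lemma cmod_ip_le: "cmod (g x y) \<le> nrm x * nrm y"
  by (rule cmod_ip_le_on[of UNIV]) auto

lemma nrm_triangle: "nrm (x + y) \<le> nrm x + nrm y"
  by (rule form_norm_triangle_on[of UNIV]) auto

lemma nrm_triangle_diff: "nrm (x - z) \<le> nrm (x - y) + nrm (y - z)"
  using nrm_triangle[of "x - y" "y - z"] by simp

lemma nrm_diff_le: "nrm (x - y) \<le> nrm x + nrm y"
  using nrm_triangle[of x "- y"] by (simp add: form_norm_minus)

lemma ip_right_eqI: "(\<And>x. g x y = g x z) \<Longrightarrow> y = z"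
  using pos[of "y - z"] by (cases "y = z") (auto simp: ip_diff_right)


section \<open>Projection onto the closure of a subspace, Riesz representation, uniform
  boundedness\<close>

text \<open>The optimal multiple of \<open>s\<close> lowers the squared norm of \<open>u\<close> by
  \<open>(cmod (g u s))\<^sup>2 / g s s\<close>, which cannot exceed the gap to
  \<open>\<delta>\<close>. Along a minimizing sequence the gap tends to zero, and orthogonality
  results in the limit.\<close>

lemma cmod_ip_square_le_gap:
  assumes min: "\<And>c. \<delta> \<le> Re (g (u - scl c s) (u - scl c s))"
  shows "(cmod (g u s))\<^sup>2 \<le> (Re (g u u) - \<delta>) * Re (g s s)"
proof (cases "s = 0")
  case False
  define d where "d = Re (g s s)"
  have "d > 0" using pos[OF False] by (simp add: d_def)
  define c where "c = g u s / of_real d"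
  have "\<delta> \<le> Re (g (u - scl c s) (u - scl c s))" by (rule min)
  also have "\<dots> = Re (g u u) - 2 * Re (cnj c * g u s) + (cmod c)\<^sup>2 * d"
    unfolding ip_self_diff ip_self_scale unfolding ip_scale_right d_def ..
  also have "cnj c * g u s = of_real ((cmod (g u s))\<^sup>2 / d)"
    by (simp add: c_def complex_norm_square mult.commute del: of_real_power)
  also have "(cmod c)\<^sup>2 * d = (cmod (g u s))\<^sup>2 / d"
    using \<open>d > 0\<close> by (simp add: c_def norm_divide power_divide power2_eq_square)
  finally have "(cmod (g u s))\<^sup>2 / d \<le> Re (g u u) - \<delta>" by simp
  then show ?thesis using \<open>d > 0\<close> by (simp add: d_def[symmetric] field_simps)
qed simp

text \<open>\<open>S\<close> is not assumed closed, so the foot point \<open>m\<close> only lies in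
  its closure; it is the limit of a minimizing sequence for the distance from
  \<open>x\<close>.\<close>

lemma ex_projection:
  assumes S: "subspace S"
  shows "\<exists>m. (\<forall>e>0. \<exists>s\<in>S. nrm (m - s) < e) \<and> (\<forall>s\<in>S. g (x - m) s = 0)"
proof -
  define Q where "Q s = Re (g (x - s) (x - s))" for s
  define \<delta> where "\<delta> = Inf (Q ` S)"
  have S0: "0 \<in> S" using S by (rule subspace_0)
  have bdd: "bdd_below (Q ` S)" by (rule bdd_belowI[of _ 0]) (auto simp: Q_def)
  have \<delta>: "\<delta> \<le> Q s" if "s \<in> S" for s
    unfolding \<delta>_def by (rule cInf_lower) (use that bdd in auto)
  have "\<exists>s\<in>S. Q s < \<delta> + 1 / real (Suc n)" for n
    using cInf_lessD[of "Q ` S" "\<delta> + 1 / real (Suc n)"] S0 by (auto simp: \<delta>_def)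
  then obtain s where s: "\<And>n. s n \<in> S" "\<And>n. Q (s n) < \<delta> + 1 / real (Suc n)" by metis
  \<comment> \<open>Parallelogram law: the midpoint \<open>h\<close> of \<open>s m\<close> and
    \<open>s n\<close> lies in \<open>S\<close>, so \<open>Q h\<close> is at least
    \<open>\<delta>\<close>, and two nearly minimal values leave little room for the
    difference.\<close>
  have gap: "(nrm (s m - s n))\<^sup>2 \<le> 4 / real (Suc k)" if "k \<le> m" "k \<le> n" for k m n
  proof -
    define u v where "u = x - s m" and "v = x - s n"
    define h where "h = scl (1/2) (s m + s n)"
    have "h \<in> S" using S s(1) by (simp add: h_def subspace_add subspace_scale)
    have 1: "u + v = scl 2 (x - h)"
    proof -
      have "scl 2 h = s m + s n" by (simp add: h_def)
      moreover have "scl 2 x = x + x" by (metis one_add_one scale_left_distrib scale_one)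
      ultimately show ?thesis by (simp add: scale_right_diff_distrib u_def v_def)
    qed
    have "Re (g (u + v) (u + v)) = 4 * Q h"
      unfolding 1 ip_self_scale by (simp add: Q_def)
    moreover have "(nrm (s m - s n))\<^sup>2 = Re (g (u - v) (u - v))"
      unfolding form_norm_minus_commute[of "s m"] nrm_square by (simp add: u_def v_def)
    moreover have "Re (g u u) + Re (g v v) \<le> 2 * \<delta> + 2 / real (Suc k)"
    proof -
      have "1 / real (Suc m) \<le> 1 / real (Suc k)" "1 / real (Suc n) \<le> 1 / real (Suc k)"
        using that by (simp_all add: frac_le)
      then show ?thesis using s(2)[of m] s(2)[of n] unfolding Q_def u_def v_def by linarith
    qed
    moreover note \<delta>[OF \<open>h \<in> S\<close>] ip_self_add[of u v] ip_self_diff[of u v]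
    ultimately show ?thesis by linarith
  qed
  obtain m where m: "(\<lambda>n. nrm (s n - m)) \<longlonglongrightarrow> 0"
  proof -
    have "\<exists>l. (\<lambda>n. nrm (s n - l)) \<longlonglongrightarrow> 0"
    proof (rule complete)
      fix e :: real assume "e > 0"
      then obtain k where k: "4 / e\<^sup>2 < real k" using reals_Archimedean2 by blast
      have "nrm (s m - s n) < e" if "k \<le> m" "k \<le> n" for m n
      proof (rule power_less_imp_less_base)
        have "4 / e\<^sup>2 < real (Suc k)" using k by simp
        then have "4 / real (Suc k) < e\<^sup>2" using \<open>e > 0\<close> by (simp add: field_simps del: of_nat_Suc)
        then show "(nrm (s m - s n))\<^sup>2 < e\<^sup>2" using gap[OF that] by linarith
      qed (use \<open>e > 0\<close> in simp)
      then show "\<exists>N. \<forall>m\<ge>N. \<forall>n\<ge>N. nrm (s m - s n) < e" by blast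
    qed
    then show ?thesis using that by blast
  qed
  show ?thesis
  proof (intro exI conjI allI impI ballI)
    fix e :: real assume "e > 0"
    with m have "\<forall>\<^sub>F n in sequentially. nrm (s n - m) < e" by (rule order_tendstoD)
    then obtain n where "nrm (s n - m) < e" using eventually_happens by force
    then show "\<exists>s\<in>S. nrm (m - s) < e" using s(1) form_norm_minus_commute by metis
  next
    fix y assume y: "y \<in> S"
    have "(cmod (g (x - s n) y))\<^sup>2 \<le> (Re (g (x - s n) (x - s n)) - \<delta>) * Re (g y y)" for n
    proof (rule cmod_ip_square_le_gap)
      fix c
      have "s n + scl c y \<in> S" using S s(1) y by (simp add: subspace_add subspace_scale)
      from \<delta>[OF this] show "\<delta> \<le> Re (g (x - s n - scl c y) (x - s n - scl c y))"
        by (simp add: Q_def diff_diff_add)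
    qed
    also have "\<dots> n \<le> (1 / real (Suc n)) * Re (g y y)" for n
      by (rule mult_right_mono) (use s(2)[of n] in \<open>auto simp: Q_def\<close>)
    finally have b: "(cmod (g (x - s n) y))\<^sup>2 \<le> (1 / real (Suc n)) * Re (g y y)" for n .
    have "(\<lambda>n. (cmod (g (x - s n) y))\<^sup>2) \<longlonglongrightarrow> 0"
    proof (rule tendsto_sandwich[where f = "\<lambda>_. 0"])
      show "(\<lambda>n. (1 / real (Suc n)) * Re (g y y)) \<longlonglongrightarrow> 0"
        using tendsto_mult_right[OF LIMSEQ_inverse_real_of_nat, of "Re (g y y)"]
        by (simp add: inverse_eq_divide)
    qed (use b in auto)
    then have l1: "(\<lambda>n. cmod (g (x - s n) y)) \<longlonglongrightarrow> 0"
      using tendsto_real_sqrt by fastforce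
    have "cmod (g (x - m) y) \<le> cmod (g (x - s n) y) + nrm (s n - m) * nrm y" for n
    proof -
      have "g (x - m) y = g (x - s n) y + g (s n - m) y" by (simp add: ip_simps)
      then show ?thesis using norm_triangle_le cmod_ip_le
        by (metis add_left_mono norm_triangle_ineq order_trans)
    qed
    moreover have "(\<lambda>n. cmod (g (x - s n) y) + nrm (s n - m) * nrm y) \<longlonglongrightarrow> 0 + 0 * nrm y"
      by (intro tendsto_intros l1 m)
    ultimately have "cmod (g (x - m) y) \<le> 0"
      by (intro LIMSEQ_le_const) auto
    then show "g (x - m) y = 0" by simp
  qed
qed

text \<open>The component \<open>w\<close> of \<open>x\<close> orthogonal to the kernel spans a
  complement: every \<open>y\<close> differs from a multiple of \<open>w\<close> by an element of
  the kernel.\<close>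

theorem Riesz:
  assumes \<phi>: "functional scl \<phi>" and C: "\<And>x. cmod (\<phi> x) \<le> C * nrm x"
  shows "\<exists>z. \<forall>x. \<phi> x = g x z"
proof (cases "\<forall>x. \<phi> x = 0")
  case True
  then show ?thesis by (intro exI[of _ 0]) simp
next
  case False
  then obtain x where x: "\<phi> x \<noteq> 0" by blast
  have add: "\<phi> (a + b) = \<phi> a + \<phi> b" and sc: "\<phi> (scl c a) = c * \<phi> a" for a b c
    using \<phi> by (auto simp: functional_def)
  have diff: "\<phi> (a - b) = \<phi> a - \<phi> b" for a b
    using add[of "a - b" b] by simp
  define S where "S = {x. \<phi> x = 0}"
  have "subspace S"
    using sc[of 0 0] by (auto simp: S_def subspace_def add sc)
  from ex_projection[OF this] obtain m where
    m: "\<And>e. e > 0 \<Longrightarrow> \<exists>s\<in>S. nrm (m - s) < e" and orth: "\<And>s. s \<in> S \<Longrightarrow> g (x - m) s = 0"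
    by blast
  \<comment> \<open>The projection only puts \<open>m\<close> in the closure of the kernel;
    boundedness of \<open>\<phi>\<close> makes the kernel closed. The denominator
    \<open>C + 1\<close> covers the case \<open>C = 0\<close>.\<close>
  have "\<phi> m = 0"
  proof (rule ccontr)
    assume "\<phi> m \<noteq> 0"
    have "C \<ge> 0"
    proof (rule ccontr)
      assume "\<not> C \<ge> 0"
      then have "C * nrm x \<le> 0" by (simp add: mult_le_0_iff)
      then show False using C[of x] x by (smt (verit) norm_le_zero_iff)
    qed
    obtain s where s: "s \<in> S" "nrm (m - s) < cmod (\<phi> m) / (C + 1)"
      using m[of "cmod (\<phi> m) / (C + 1)"] \<open>\<phi> m \<noteq> 0\<close> \<open>C \<ge> 0\<close> by auto
    have "cmod (\<phi> m) = cmod (\<phi> (m - s))" using s(1) by (simp add: diff S_def)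
    also have "\<dots> \<le> C * nrm (m - s)" by (rule C)
    also have "\<dots> \<le> (C + 1) * nrm (m - s)" by (simp add: mult_right_mono)
    also have "\<dots> < cmod (\<phi> m)" using s(2) \<open>C \<ge> 0\<close> by (simp add: field_simps)
    finally show False by simp
  qed
  define w where "w = x - m"
  have w: "\<phi> w \<noteq> 0" using x \<open>\<phi> m = 0\<close> by (simp add: w_def diff)
  then have "w \<noteq> 0" using sc[of 0 w] by auto
  then have gw: "g w w \<noteq> 0" using pos[of w] by auto
  have "\<phi> y = g y (scl (cnj (\<phi> w / g w w)) w)" for y
  proof -
    have "y - scl (\<phi> y / \<phi> w) w \<in> S" using w by (simp add: S_def diff sc)
    then have "g w (y - scl (\<phi> y / \<phi> w) w) = 0" unfolding w_def by (rule orth)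
    then have "g (y - scl (\<phi> y / \<phi> w) w) w = 0" by (subst ip_commute) simp
    then have "g y w = \<phi> y / \<phi> w * g w w" by (simp add: ip_simps)
    then show ?thesis using w gw by (simp add: ip_scale_right)
  qed
  then show ?thesis by blast
qed

lemma nrm_le_of_ip_bound:
  assumes "\<And>x. cmod (g x z) \<le> C * nrm x" and "0 \<le> C"
  shows "nrm z \<le> C"
proof (cases "z = 0")
  case False
  have "nrm z * nrm z \<le> C * nrm z"
    using assms(1)[of z] by (simp add: ip_self_nrm power2_eq_square norm_mult)
  then show ?thesis using nrm_pos[OF False] by simp
qed (simp add: assms)

lemma nrm_scale_real: "nrm (scl (of_real t) x) = \<bar>t\<bar> * nrm x"
  by (simp add: form_norm_scale)

lemma nrm_normalize: "x \<noteq> 0 \<Longrightarrow> nrm (scl (of_real (1 / nrm x)) x) = 1"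
  using nrm_pos[of x] unfolding nrm_scale_real by simp

text \<open>A gliding hump: if \<open>S\<close> is unbounded, pick \<open>y n \<in> S\<close> with norm exceeding \<open>6 ^ n\<close> and move from
  \<open>x n\<close> by at most \<open>3 ^ - (n + 1)\<close> so that the pairing with \<open>y n\<close> becomes large; the later moves
  cannot undo this.\<close>

theorem weakly_bounded_imp_bounded:
  assumes wb: "\<And>x. \<exists>C. \<forall>y\<in>S. cmod (g x y) \<le> C"
  shows "\<exists>C. \<forall>y\<in>S. nrm y \<le> C"
proof (rule ccontr)
  assume "\<not> ?thesis"
  then have "\<exists>y\<in>S. nrm y > 6 ^ n" for n :: nat by (meson not_le)
  then obtain y where y: "\<And>n. y n \<in> S" "\<And>n::nat. nrm (y n) > 6 ^ n" by metis
  define r :: "nat \<Rightarrow> real" where "r n = (1/3) ^ n" for n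
  have r_pos: "r n > 0" for n by (simp add: r_def)
  \<comment> \<open>One of \<open>x + b\<close> and \<open>x - b\<close> pairs largely with
    \<open>y n\<close>, since the two pairings differ by \<open>2 * g b (y n)\<close>.\<close>
  have "\<exists>x'. nrm (x' - x) \<le> r (Suc n) \<and> r (Suc n) * nrm (y n) \<le> cmod (g x' (y n))" for x n
  proof -
    have ny: "nrm (y n) > 0" using y(2)[of n] by (smt (verit) zero_less_power)
    define b where "b = scl (of_real (r (Suc n) / nrm (y n))) (y n)"
    have nb: "nrm b = r (Suc n)"
      using ny r_pos[of "Suc n"] unfolding b_def nrm_scale_real by auto
    have gb: "g b (y n) = of_real (r (Suc n) * nrm (y n))"
      using ny by (simp add: b_def ip_scale_left ip_self_nrm power2_eq_square)
    have "cmod (2 * g b (y n)) = cmod (g (x + b) (y n) - g (x - b) (y n))"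
      by (simp add: ip_simps)
    also have "\<dots> \<le> cmod (g (x + b) (y n)) + cmod (g (x - b) (y n))" by (rule norm_triangle_ineq4)
    also have "cmod (2 * g b (y n)) = 2 * (r (Suc n) * nrm (y n))"
      using ny r_pos[of "Suc n"] by (simp add: gb norm_mult)
    finally consider "r (Suc n) * nrm (y n) \<le> cmod (g (x + b) (y n))"
      | "r (Suc n) * nrm (y n) \<le> cmod (g (x - b) (y n))" by linarith
    then show ?thesis
    proof cases
      case 1
      then show ?thesis using nb by (intro exI[of _ "x + b"]) simp
    next
      case 2
      then show ?thesis using nb by (intro exI[of _ "x - b"]) (simp add: form_norm_minus)
    qed
  qed
  then obtain x where x: "\<And>n. nrm (x (Suc n) - x n) \<le> r (Suc n)"
      "\<And>n. r (Suc n) * nrm (y n) \<le> cmod (g (x (Suc n)) (y n))"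
    using dependent_nat_choice[of "\<lambda>_ _. True"
        "\<lambda>n x x'. nrm (x' - x) \<le> r (Suc n) \<and> r (Suc n) * nrm (y n) \<le> cmod (g x' (y n))"]
    by blast
  \<comment> \<open>Geometric series with ratio 1/3: all moves after \<open>x n\<close> add up to at
    most \<open>r n / 2\<close>. So the moves after \<open>x (Suc n)\<close> lose at most half of
    the pairing won there.\<close>
  have "nrm (x (n + k) - x n) \<le> r n * (1 - (1/3) ^ k) / 2" for n k
  proof (induction k)
    case (Suc k)
    have "nrm (x (n + Suc k) - x n) \<le> nrm (x (Suc (n + k)) - x (n + k)) + nrm (x (n + k) - x n)"
      using nrm_triangle_diff by simp
    also have "\<dots> \<le> r n * (1/3) ^ k / 3 + r n * (1 - (1/3) ^ k) / 2"
      using x(1)[of "n + k"] Suc by (simp add: r_def power_add)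
    also have "\<dots> = r n * (1 - (1/3) ^ Suc k) / 2" by (simp add: field_simps)
    finally show ?case .
  qed simp
  then have tail: "nrm (x (n + k) - x n) \<le> r n / 2" for n k
    using r_pos[of n] by (smt (verit) divide_right_mono mult_left_le zero_le_power zero_le_divide_1_iff)
  have "\<exists>l. (\<lambda>n. nrm (x n - l)) \<longlonglongrightarrow> 0"
  proof (rule complete)
    fix e :: real assume "e > 0"
    then obtain N where N: "(1/3) ^ N < e" using real_arch_pow_inv[of e "1/3"] by auto
    have "nrm (x m - x n) < e" if "N \<le> m" "N \<le> n" for m n
    proof -
      have "nrm (x m - x N) \<le> r N / 2" "nrm (x n - x N) \<le> r N / 2"
        using tail[of N "m - N"] tail[of N "n - N"] that by simp_all
      then have "nrm (x m - x n) \<le> r N"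
        using nrm_triangle_diff[of "x m" "x n" "x N"] form_norm_minus_commute[of "x N" "x n"]
        by linarith
      then show ?thesis using N by (simp add: r_def)
    qed
    then show "\<exists>N. \<forall>m\<ge>N. \<forall>n\<ge>N. nrm (x m - x n) < e" by blast
  qed
  then obtain l where l: "(\<lambda>n. nrm (x n - l)) \<longlonglongrightarrow> 0" by blast
  have dl: "nrm (x n - l) \<le> r n / 2" for n
  proof -
    have "nrm (x n - l) \<le> r n / 2 + nrm (x (k + n) - l)" for k
      using nrm_triangle_diff[of "x n" l "x (k + n)"] tail[of n k]
        form_norm_minus_commute[of "x n" "x (k + n)"] by (simp add: add.commute)
    moreover have "(\<lambda>k. r n / 2 + nrm (x (k + n) - l)) \<longlonglongrightarrow> r n / 2 + 0"
      using LIMSEQ_ignore_initial_segment[OF l, of n] by (intro tendsto_intros)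
    ultimately show ?thesis by (intro LIMSEQ_le_const) auto
  qed
  obtain C where C: "\<And>n. cmod (g l (y n)) \<le> C" using wb y(1) by metis
  \<comment> \<open>Half of \<open>r (Suc n) * nrm (y n)\<close> survives in the limit, and
    \<open>r (Suc n) * 6 ^ n = 2 ^ n / 3\<close> is unbounded; the growth rate 6 was taken above 3
    for this.\<close>
  have "2 ^ n \<le> 6 * C" for n :: nat
  proof -
    have "g (x (Suc n)) (y n) = g l (y n) + g (x (Suc n) - l) (y n)" by (simp add: ip_simps)
    then have "cmod (g (x (Suc n)) (y n)) \<le> cmod (g l (y n)) + cmod (g (x (Suc n) - l) (y n))"
      by (simp add: norm_triangle_ineq)
    then have "r (Suc n) * nrm (y n) \<le> C + nrm (x (Suc n) - l) * nrm (y n)"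
      using x(2)[of n] C[of n] cmod_ip_le[of "x (Suc n) - l" "y n"] by linarith
    also have "nrm (x (Suc n) - l) * nrm (y n) \<le> r (Suc n) / 2 * nrm (y n)"
      by (rule mult_right_mono[OF dl]) simp
    finally have "r (Suc n) * nrm (y n) \<le> 2 * C" by simp
    moreover have "r (Suc n) * 6 ^ n \<le> r (Suc n) * nrm (y n)"
      using y(2)[of n] r_pos[of "Suc n"] by simp
    moreover have "r (Suc n) * 6 ^ n = 2 ^ n / 3"
    proof -
      have "(1/3) ^ n * 6 ^ n = (2 :: real) ^ n" unfolding power_mult_distrib[symmetric] by simp
      then show ?thesis by (simp add: r_def)
    qed
    ultimately show ?thesis by linarith
  qed
  then show False using real_arch_pow[of 2 "6 * C"] by (meson not_le one_less_numeral_iff semiring_norm(76))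
qed

section \<open>Orthonormal bases and Parseval's identity\<close>

text \<open>Zorn: a nonzero vector orthogonal to a maximal orthonormal set could be normalized and
  added. The existence of a basis is what makes the value described by \<open>J_trace\<close>
  unique.\<close>

lemma ex_orthonormal_basis: "\<exists>E. orthonormal_basis g E"
proof -
  define \<O> where "\<O> = {E. \<forall>e\<in>E. \<forall>f\<in>E. g e f = (if e = f then 1 else 0)}"
  have "\<exists>M\<in>\<O>. \<forall>X\<in>\<O>. M \<subseteq> X \<longrightarrow> X = M"
  proof (rule subset_Zorn_nonempty)
    fix \<C> assume ch: "subset.chain \<O> \<C>"
    have "g e f = (if e = f then 1 else 0)" if ef: "e \<in> \<Union>\<C>" "f \<in> \<Union>\<C>" for e f
    proof -
      obtain X Y where "X \<in> \<C>" "Y \<in> \<C>" "e \<in> X" "f \<in> Y" using ef by blast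
      moreover from this have "X \<subseteq> Y \<or> Y \<subseteq> X"
        using ch unfolding subset_chain_def by blast
      ultimately obtain Z where "Z \<in> \<C>" "e \<in> Z" "f \<in> Z" by (metis subsetD)
      moreover from this have "Z \<in> \<O>" using ch unfolding subset_chain_def by blast
      ultimately show ?thesis unfolding \<O>_def by blast
    qed
    then show "\<Union>\<C> \<in> \<O>" unfolding \<O>_def by blast
  next
    have "{} \<in> \<O>" by (simp add: \<O>_def)
    then show "\<O> \<noteq> {}" by blast
  qed
  then obtain E where E: "E \<in> \<O>" and max: "\<And>X. X \<in> \<O> \<Longrightarrow> E \<subseteq> X \<Longrightarrow> X = E" by blast
  have "x = 0" if x: "\<forall>e\<in>E. g x e = 0" for x
  proof (rule ccontr)
    assume "x \<noteq> 0"
    define u where "u = scl (of_real (1 / nrm x)) x"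
    have u: "g u u = 1"
      unfolding u_def ip_self_nrm nrm_normalize[OF \<open>x \<noteq> 0\<close>] by simp
    have ue: "g u e = 0" "g e u = 0" if "e \<in> E" for e
      using x that ip_commute[of e x] by (simp_all add: u_def ip_simps)
    have "u \<notin> E" using u ue(1) by force
    have "g e f = (if e = f then 1 else 0)" if "e \<in> insert u E" "f \<in> insert u E" for e f
    proof (cases "e = u \<or> f = u")
      case True
      then show ?thesis using that u ue \<open>u \<notin> E\<close> by auto
    next
      case False
      then have "e \<in> E" "f \<in> E" using that by simp_all
      then show ?thesis using E unfolding \<O>_def by blast
    qed
    then have "insert u E \<in> \<O>" unfolding \<O>_def by blast
    from max[OF this] show False using \<open>u \<notin> E\<close> by blast
  qed
  then show ?thesis using E unfolding orthonormal_basis_def \<O>_def by blast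
qed

text \<open>Serves twice: with the Fourier coefficients for \<open>c\<close> it gives Bessel's
  inequality, with arbitrary \<open>c\<close> it shows that the Fourier sum over \<open>F\<close>
  approximates \<open>y\<close> at least as well as any other combination.\<close>

lemma orthonormal_expansion_error:
  assumes E: "orthonormal_basis g E" and F: "finite F" "F \<subseteq> E"
  shows "Re (g (y - (\<Sum>e\<in>F. scl (c e) e)) (y - (\<Sum>e\<in>F. scl (c e) e))) =
    (nrm y)\<^sup>2 - (\<Sum>e\<in>F. (cmod (g y e))\<^sup>2) + (\<Sum>e\<in>F. (cmod (g y e - c e))\<^sup>2)"
proof -
  let ?s = "\<Sum>e\<in>F. scl (c e) e"
  have on: "g e f = (if e = f then 1 else 0)" if "e \<in> F" "f \<in> F" for e f
  proof -
    have "\<forall>e\<in>E. \<forall>f\<in>E. g e f = (if e = f then 1 else 0)"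
      using E by (simp add: orthonormal_basis_def)
    then show ?thesis using F(2) that by (meson subsetD)
  qed
  have ys: "g y ?s = (\<Sum>e\<in>F. cnj (c e) * g y e)"
    by (simp add: ip_sum_right ip_scale_right)
  have "g ?s ?s = (\<Sum>f\<in>F. \<Sum>e\<in>F. cnj (c f) * (c e * g e f))"
    by (simp add: ip_sum_right ip_scale_right ip_sum_left ip_scale_left sum_distrib_left)
  also have "\<dots> = (\<Sum>f\<in>F. \<Sum>e\<in>F. if e = f then cnj (c f) * c e else 0)"
    by (intro sum.cong refl) (auto simp: on)
  also have "\<dots> = (\<Sum>e\<in>F. cnj (c e) * c e)" using F by (simp add: sum.delta)
  finally have ss: "Re (g ?s ?s) = (\<Sum>e\<in>F. (cmod (c e))\<^sup>2)"
    by (simp only: Re_sum cmod_power2) (simp add: power2_eq_square)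
  have "(cmod (g y e - c e))\<^sup>2 = (cmod (g y e))\<^sup>2 - 2 * Re (cnj (c e) * g y e) + (cmod (c e))\<^sup>2"
    for e unfolding cmod_power2 by (simp add: power2_eq_square algebra_simps)
  then show ?thesis
    unfolding ip_self_diff ys ss nrm_square
    by (simp add: sum.distrib sum_subtractf flip: sum_distrib_left)
qed

text \<open>A basis is defined by totality, so the density of its span has to be derived: the
  projection \<open>m\<close> of \<open>y\<close> leaves a remainder orthogonal to \<open>E\<close>,
  which is zero.\<close>

theorem Parseval:
  assumes E: "orthonormal_basis g E"
  shows "((\<lambda>e. (cmod (g y e))\<^sup>2) has_sum (nrm y)\<^sup>2) E"
proof -
  have bessel: "(\<Sum>e\<in>F. (cmod (g y e))\<^sup>2) \<le> (nrm y)\<^sup>2" if "finite F" "F \<subseteq> E" for F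
    using orthonormal_expansion_error[OF E that, of y "g y"]
      nonneg[of "y - (\<Sum>e\<in>F. scl (g y e) e)"] by simp
  obtain m where m: "\<And>e. e > 0 \<Longrightarrow> \<exists>s\<in>span E. nrm (m - s) < e"
      and orth: "\<And>s. s \<in> span E \<Longrightarrow> g (y - m) s = 0"
    using ex_projection[OF subspace_span[of E], of y] by blast
  have "\<forall>e\<in>E. g (y - m) e = 0" using orth span_base by blast
  then have "y - m = 0" using E unfolding orthonormal_basis_def by blast
  then have "m = y" by simp
  show ?thesis unfolding has_sum_def tendsto_iff eventually_finite_subsets_at_top
  proof (intro allI impI)
    fix \<epsilon> :: real assume "\<epsilon> > 0"
    then obtain s where s: "s \<in> span E" "nrm (y - s) < sqrt \<epsilon>"
      using m[of "sqrt \<epsilon>"] \<open>m = y\<close> by auto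
    obtain c F where F: "finite F" "F \<subseteq> E" and s_eq: "s = (\<Sum>e\<in>F. scl (c e) e)"
      using s(1) unfolding span_explicit by blast
    have "(nrm (y - s))\<^sup>2 < (sqrt \<epsilon>)\<^sup>2"
      using s(2) by (intro power_strict_mono) auto
    moreover have "0 \<le> (\<Sum>e\<in>F. (cmod (g y e - c e))\<^sup>2)" by (simp add: sum_nonneg)
    ultimately have gap: "(nrm y)\<^sup>2 - (\<Sum>e\<in>F. (cmod (g y e))\<^sup>2) < \<epsilon>"
      using orthonormal_expansion_error[OF E F, of y c] \<open>\<epsilon> > 0\<close>
      by (simp add: nrm_square s_eq)
    show "\<exists>X. finite X \<and> X \<subseteq> E \<and> (\<forall>Y. finite Y \<and> X \<subseteq> Y \<and> Y \<subseteq> E \<longrightarrow>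
        dist (\<Sum>e\<in>Y. (cmod (g y e))\<^sup>2) ((nrm y)\<^sup>2) < \<epsilon>)"
    proof (intro exI conjI allI impI)
      fix Y assume Y: "finite Y \<and> F \<subseteq> Y \<and> Y \<subseteq> E"
      then have "(\<Sum>e\<in>F. (cmod (g y e))\<^sup>2) \<le> (\<Sum>e\<in>Y. (cmod (g y e))\<^sup>2)"
        by (intro sum_mono2) auto
      then show "dist (\<Sum>e\<in>Y. (cmod (g y e))\<^sup>2) ((nrm y)\<^sup>2) < \<epsilon>"
        using gap bessel[of Y] Y by (simp add: dist_real_def)
    qed (use F in auto)
  qed
qed

section \<open>Comparison of quadratic forms of symmetric operators\<close>

text \<open>Polarization: reality at \<open>x + y\<close> matches the imaginary parts of the two
  sides, reality at \<open>x + scl \<i> y\<close> the real parts.\<close>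

lemma form_symmetric:
  assumes R: "Vector_Spaces.linear scl scl R" and real: "\<And>x. Im (g (R x) x) = 0"
  shows "g (R x) y = cnj (g (R y) x)"
proof -
  interpret R: Vector_Spaces.linear scl scl R by (rule R)
  show ?thesis
    using real[of "x + y"] real[of "x + scl \<i> y"] real[of x] real[of y]
    by (simp add: R.add R.scale ip_simps complex_eq_iff)
qed

text \<open>Operator monotonicity of the square root: \<open>T\<^sup>2 \<le> R\<^sup>2\<close> implies \<open>T \<le> R\<close>. Otherwise the supremum
  \<open>m > 0\<close> of the numerical range of \<open>T - R\<close> has approximate eigenvectors \<open>x\<close>, and
  \<open>T x \<approx> R x + m x\<close> contradicts the hypothesis on the norms.\<close>

theorem quadratic_form_le_of_norm_le:
  assumes T: "Vector_Spaces.linear scl scl T" and R: "Vector_Spaces.linear scl scl R"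
    and C: "\<And>x. nrm (R x) \<le> C * nrm x" and C0: "0 \<le> C"
    and symT: "\<And>x. Im (g (T x) x) = 0" and posR: "\<And>x. 0 \<le> g (R x) x"
    and le: "\<And>x. nrm (T x) \<le> nrm (R x)"
  shows "Re (g (T x) x) \<le> Re (g (R x) x)"
proof (rule ccontr)
  assume x: "\<not> ?thesis"
  interpret T: Vector_Spaces.linear scl scl T by (rule T)
  interpret R: Vector_Spaces.linear scl scl R by (rule R)
  have imR: "Im (g (R x) x) = 0" for x using posR[of x] by (simp add: less_eq_complex_def)
  define D where "D x = T x - R x" for x
  have D: "D (x + y) = D x + D y" "D (scl c x) = scl c (D x)" for x y c
    by (simp_all add: D_def T.add R.add T.scale R.scale scale_right_diff_distrib)
  have nrmD: "nrm (D x) \<le> 2 * C * nrm x" for x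
    using nrm_diff_le[of "T x" "R x"] le[of x] C[of x] by (simp add: D_def)
  have bound: "\<bar>Re (g (D x) x)\<bar> \<le> 2 * C * (nrm x)\<^sup>2" for x
  proof -
    have "\<bar>Re (g (D x) x)\<bar> \<le> nrm (D x) * nrm x"
      using abs_Re_le_cmod cmod_ip_le order_trans by blast
    also have "\<dots> \<le> 2 * C * nrm x * nrm x" by (rule mult_right_mono[OF nrmD]) simp
    finally show ?thesis by (simp add: power2_eq_square)
  qed
  define V where "V = (\<lambda>x. Re (g (D x) x)) ` {x. nrm x = 1}"
  define m where "m = Sup V"
  have bdd: "bdd_above V"
  proof (intro bdd_aboveI)
    fix v assume "v \<in> V"
    then obtain y where "v = Re (g (D y) y)" "nrm y = 1" by (auto simp: V_def)
    then show "v \<le> 2 * C" using bound[of y] by simp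
  qed
  have le_m: "Re (g (D x) x) \<le> m * (nrm x)\<^sup>2" for x
  proof (cases "x = 0")
    case True
    then show ?thesis using bound[of x] by simp
  next
    case False
    define u where "u = scl (of_real (1 / nrm x)) x"
    have "nrm u = 1" unfolding u_def by (rule nrm_normalize[OF False])
    then have "Re (g (D u) u) \<le> m" unfolding m_def by (intro cSup_upper bdd) (auto simp: V_def)
    moreover have "g (D u) u = of_real ((1 / nrm x)\<^sup>2) * g (D x) x"
      by (simp add: u_def D ip_simps power2_eq_square)
    ultimately show ?thesis using nrm_pos[OF False]
      by (simp add: field_simps power2_eq_square)
  qed
  have "Re (g (D x) x) > 0" using x by (simp add: D_def ip_simps)
  with le_m[of x] have m0: "m > 0" by (smt (verit) mult_nonpos_nonneg zero_le_power2)
  have "V \<noteq> {}"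
  proof
    assume "V = {}"
    then have "nrm x \<noteq> 1" for x by (auto simp: V_def)
    moreover have "x \<noteq> 0" using \<open>Re (g (D x) x) > 0\<close> by auto
    then have "nrm (scl (of_real (1 / nrm x)) x) = 1"
      by (rule nrm_normalize)
    ultimately show False by blast
  qed
  define S where "S x = scl (of_real m) x - D x" for x
  define s where "s x y = g (S x) y" for x y
  interpret s: hermitian_space scl s
  proof unfold_locales
    fix x y
    have "g (R x) y = cnj (g (R y) x)" "g (T x) y = cnj (g (T y) x)"
      by (rule form_symmetric[OF R imR], rule form_symmetric[OF T symT])
    then show "s x y = cnj (s y x)"
      using ip_commute[of x y] by (simp add: s_def S_def D_def ip_simps)
  qed (simp_all add: s_def S_def D ip_simps algebra_simps)
  have s_self: "Re (s x x) = m * (nrm x)\<^sup>2 - Re (g (D x) x)" for x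
    by (simp add: s_def S_def ip_simps nrm_square)
  have s_pos: "0 \<le> Re (s x x)" for x using le_m[of x] by (simp add: s_self)
  define K where "K = m + 2 * C"
  have K0: "K > 0" using m0 C0 by (simp add: K_def)
  \<comment> \<open>Cauchy-Schwarz for the semidefinite form \<open>s\<close> at \<open>x\<close>
    and \<open>S x\<close>: a bounded positive operator is small at \<open>x\<close> as soon as its
    form is. This turns an almost maximal value into an approximate eigenvector without spectral
    theory.\<close>
  have S_bound: "(nrm (S x))\<^sup>2 \<le> K * Re (s x x)" for x
  proof (cases "S x = 0")
    case True
    then show ?thesis using K0 s_pos by simp
  next
    case False
    have "(cmod (s x (S x)))\<^sup>2 \<le> Re (s x x) * Re (s (S x) (S x))"
      by (rule s.Cauchy_Schwarz_on[of UNIV]) (auto simp: s_pos)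
    also have "\<dots> \<le> Re (s x x) * (K * (nrm (S x))\<^sup>2)"
      using bound[of "S x"] by (intro mult_left_mono s_pos) (simp add: s_self K_def algebra_simps)
    also have "cmod (s x (S x)) = (nrm (S x))\<^sup>2" by (simp add: s_def ip_self_nrm norm_power)
    finally show ?thesis using nrm_pos[OF False] by (simp add: power2_eq_square field_simps)
  qed
  \<comment> \<open>Chosen such that \<open>2 * C * \<delta> + \<delta>\<^sup>2 < m\<^sup>2\<close>;
    the bound by 1 allows \<open>\<delta>\<^sup>2\<close> to be replaced by
    \<open>\<delta>\<close>.\<close>
  define \<delta> where "\<delta> = min 1 (m\<^sup>2 / (4 * C + 4))"
  have "\<delta> > 0" "\<delta> \<le> 1" using m0 C0 by (simp_all add: \<delta>_def)
  have "\<exists>x. nrm x = 1 \<and> m - \<delta>\<^sup>2 / K < Re (g (D x) x)"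
    using less_cSupD[OF \<open>V \<noteq> {}\<close>, of "m - \<delta>\<^sup>2 / K"] \<open>\<delta> > 0\<close> K0
    by (auto simp: V_def m_def)
  then obtain u where u: "nrm u = 1" "m - \<delta>\<^sup>2 / K < Re (g (D u) u)" by blast
  have "(nrm (S u))\<^sup>2 < \<delta>\<^sup>2"
  proof -
    have "Re (s u u) < \<delta>\<^sup>2 / K" using u by (simp add: s_self)
    then have "K * Re (s u u) < \<delta>\<^sup>2" using K0 by (simp add: field_simps)
    then show ?thesis using S_bound[of u] by linarith
  qed
  then have "nrm (S u) < \<delta>" using \<open>\<delta> > 0\<close> by (simp add: power_less_imp_less_base)
  have TS: "T u + S u = R u + scl (of_real m) u" by (simp add: S_def D_def)
  \<comment> \<open>The cross term is nonnegative, so adding \<open>scl (of_real m) u\<close> to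
    \<open>R u\<close> raises the squared norm by at least \<open>m\<^sup>2\<close>, whereas the
    norm of \<open>T u + S u\<close> exceeds that of \<open>R u\<close> by at most
    \<open>\<delta>\<close>.\<close>
  have "(nrm (T u + S u))\<^sup>2 = (nrm (R u))\<^sup>2 + 2 * m * Re (g (R u) u) + m\<^sup>2"
    using u(1) unfolding TS nrm_square ip_self_add ip_self_scale unfolding nrm_square[symmetric]
    by (simp add: ip_simps)
  moreover have "0 \<le> 2 * m * Re (g (R u) u)"
    using m0 posR[of u] by (simp add: less_eq_complex_def)
  moreover have "nrm (T u + S u) \<le> nrm (R u) + \<delta>"
    using nrm_triangle[of "T u" "S u"] le[of u] \<open>nrm (S u) < \<delta>\<close> by linarith
  then have "(nrm (T u + S u))\<^sup>2 \<le> (nrm (R u) + \<delta>)\<^sup>2" by (rule power_mono) simp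
  ultimately have "m\<^sup>2 \<le> 2 * nrm (R u) * \<delta> + \<delta>\<^sup>2"
    unfolding power2_sum by linarith
  also have "\<dots> \<le> 2 * C * \<delta> + \<delta>"
    using C[of u] u(1) \<open>\<delta> > 0\<close> \<open>\<delta> \<le> 1\<close>
    by (intro add_mono mult_left_mono mult_right_mono) (auto simp: power2_eq_square mult_left_le)
  also have "\<dots> = \<delta> * (2 * C + 1)" by (simp add: algebra_simps)
  also have "\<dots> \<le> m\<^sup>2 / (4 * C + 4) * (2 * C + 1)"
    using C0 by (intro mult_right_mono) (auto simp: \<delta>_def)
  also have "\<dots> < m\<^sup>2"
    using m0 C0 by (simp add: field_simps add_pos_nonneg)
  finally show False by simp
qed

end

section \<open>Traces of quadratic forms\<close>

text \<open>Tonelli for unordered sums: nonnegativity makes the family summable on the product. In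
  the applications one index numbers functionals and the other runs over a basis.\<close>

lemma has_sum_exchange_nonneg:
  fixes f :: "'i \<Rightarrow> 'j \<Rightarrow> real"
  assumes nonneg: "\<And>i j. 0 \<le> f i j"
    and row: "\<And>i. i \<in> I \<Longrightarrow> (f i has_sum r i) K" and r: "(r has_sum t) I"
    and col: "\<And>j. j \<in> K \<Longrightarrow> ((\<lambda>i. f i j) has_sum c j) I"
  shows "(c has_sum t) K"
proof -
  have "(\<lambda>(i, j). f i j) summable_on I \<times> K"
    by (rule summable_on_SigmaI[where g = r]) (use row r nonneg in \<open>auto simp: has_sum_iff\<close>)
  then have "((\<lambda>(i, j). f i j) has_sum t) (I \<times> K)"
    by (intro has_sum_SigmaI[OF _ r]) (auto simp: row)
  then have "((\<lambda>(j, i). f i j) has_sum t) (K \<times> I)"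
    by (subst (asm) has_sum_swap) simp
  then show ?thesis
    by (rule has_sum_SigmaD) (auto simp: col)
qed

lemma summable_exchange_nonneg:
  fixes f :: "'i \<Rightarrow> 'j \<Rightarrow> real"
  assumes nonneg: "\<And>i j. 0 \<le> f i j"
    and row: "\<And>i. i \<in> I \<Longrightarrow> (f i has_sum r i) K" and r: "r summable_on I"
    and col: "\<And>j. j \<in> K \<Longrightarrow> ((\<lambda>i. f i j) has_sum c j) I"
  shows "c summable_on K"
  using has_sum_exchange_nonneg[OF nonneg row _ col] r unfolding summable_on_def by blast

text \<open>One step of the Cholesky decomposition: subtract from \<open>p\<close> the square of the functional
  \<open>p _ v / sqrt (p v v)\<close>. If \<open>p v v = 0\<close> then nothing is subtracted, since division by zero
  yields zero.\<close>

definition deflate :: "('a \<Rightarrow> 'a \<Rightarrow> complex) \<Rightarrow> 'a \<Rightarrow> 'a \<Rightarrow> 'a \<Rightarrow> complex" where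
  "deflate p v x y = p x y - p x v * p v y / p v v"

text \<open>The Schur complement of \<open>p\<close> after eliminating \<open>d 0\<close>, ...,
  \<open>d (n - 1)\<close>.\<close>

primrec cholesky_remainder ::
  "('a \<Rightarrow> 'a \<Rightarrow> complex) \<Rightarrow> (nat \<Rightarrow> 'a) \<Rightarrow> nat \<Rightarrow> 'a \<Rightarrow> 'a \<Rightarrow> complex" where
  "cholesky_remainder p d 0 = p"
| "cholesky_remainder p d (Suc n) = deflate (cholesky_remainder p d n) (d n)"

text \<open>The \<open>n\<close>-th row of the Cholesky factor. A zero pivot gives the zero
  functional, again by division by zero, in agreement with \<open>deflate\<close>.\<close>

definition cholesky_functional ::
  "('a \<Rightarrow> 'a \<Rightarrow> complex) \<Rightarrow> (nat \<Rightarrow> 'a) \<Rightarrow> nat \<Rightarrow> 'a \<Rightarrow> complex" where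
  "cholesky_functional p d n x =
     cholesky_remainder p d n x (d n) / of_real (sqrt (Re (cholesky_remainder p d n (d n) (d n))))"

section \<open>Cholesky decomposition of a positive semidefinite form\<close>

context hermitian_space
begin

lemma hermitian_deflate: "hermitian_space scl (deflate ip v)"
proof unfold_locales
  fix x y
  have "cnj (ip v v) = ip v v" by (metis ip_commute)
  then show "deflate ip v x y = cnj (deflate ip v y x)"
    using ip_commute[of x y] ip_commute[of x v] ip_commute[of v y]
    by (simp add: deflate_def mult.commute)
qed (simp_all add: deflate_def ip_simps algebra_simps add_divide_distrib)

lemma deflate_self:
  "Re (deflate ip v x x) = Re (ip x x) - (cmod (ip x v))\<^sup>2 / Re (ip v v)"
proof -
  have "ip x v * ip v x = of_real ((cmod (ip x v))\<^sup>2)"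
    by (metis complex_norm_square ip_commute of_real_power)
  then have "ip x v * ip v x / ip v v = of_real ((cmod (ip x v))\<^sup>2 / Re (ip v v))"
    by (subst ip_self[of v]) (simp del: of_real_power)
  then show ?thesis by (simp add: deflate_def)
qed

context
  assumes nonneg: "\<And>x. 0 \<le> Re (ip x x)"
begin

text \<open>This is the Cauchy-Schwarz inequality divided by \<open>ip v v\<close>.\<close>

lemma deflate_nonneg: "0 \<le> Re (deflate ip v x x)"
proof (cases "Re (ip v v) = 0")
  case False
  then have "Re (ip v v) > 0" using nonneg[of v] by simp
  then show ?thesis
    using Cauchy_Schwarz_on[of UNIV x v] nonneg by (simp add: deflate_self field_simps)
qed (simp add: deflate_self nonneg)

lemma deflate_le: "Re (deflate ip v x x) \<le> Re (ip x x)"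
  by (simp add: deflate_self nonneg)

lemma deflate_vanishes: "Re (deflate ip v v v) = 0"
proof -
  have "cmod (ip v v) = Re (ip v v)"
    using nonneg[of v] by (subst (1) ip_self) simp
  then show ?thesis by (simp add: deflate_self power2_eq_square)
qed

lemma cholesky_remainder:
  "hermitian_space scl (cholesky_remainder ip d n) \<and> (\<forall>x. 0 \<le> Re (cholesky_remainder ip d n x x))"
proof (induction n)
  case 0
  then show ?case using hermitian_space_axioms nonneg by simp
next
  case (Suc n)
  then interpret P: hermitian_space scl "cholesky_remainder ip d n" by simp
  show ?case using Suc by (simp add: P.hermitian_deflate P.deflate_nonneg)
qed

lemma cholesky_remainder_antimono:
  assumes "m \<le> n"
  shows "Re (cholesky_remainder ip d n x x) \<le> Re (cholesky_remainder ip d m x x)"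
  using assms
proof (induction n rule: dec_induct)
  case (step n)
  interpret P: hermitian_space scl "cholesky_remainder ip d n" using cholesky_remainder by blast
  show ?case using P.deflate_le[of "d n" x] cholesky_remainder[of d n] step by simp
qed simp

text \<open>A step kills the form at its own pivot vector, and all later remainders are squeezed
  between zero and this value.\<close>

lemma cholesky_remainder_vanishes:
  assumes "k < n"
  shows "Re (cholesky_remainder ip d n (d k) (d k)) = 0"
proof (rule antisym)
  interpret P: hermitian_space scl "cholesky_remainder ip d k" using cholesky_remainder by blast
  have "Re (cholesky_remainder ip d (Suc k) (d k) (d k)) = 0"
    using P.deflate_vanishes[of "d k"] cholesky_remainder[of d k] by simp
  then show "Re (cholesky_remainder ip d n (d k) (d k)) \<le> 0"
    using cholesky_remainder_antimono[of "Suc k" n d "d k"] assms by simp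
qed (use cholesky_remainder in blast)

lemma cmod_cholesky_functional:
  "(cmod (cholesky_functional ip d n x))\<^sup>2 =
    Re (cholesky_remainder ip d n x x) - Re (cholesky_remainder ip d (Suc n) x x)"
proof -
  interpret P: hermitian_space scl "cholesky_remainder ip d n" using cholesky_remainder by blast
  show ?thesis
    using cholesky_remainder[of d n]
    by (simp add: P.deflate_self cholesky_functional_def norm_divide power_divide)
qed

lemma sum_cholesky_functional:
  "(\<Sum>k<n. (cmod (cholesky_functional ip d k x))\<^sup>2) =
    Re (ip x x) - Re (cholesky_remainder ip d n x x)"
  by (induction n) (simp_all only: sum.lessThan_Suc cmod_cholesky_functional, simp_all)

lemma functional_cholesky: "functional scl (cholesky_functional ip d n)"
proof -
  interpret P: hermitian_space scl "cholesky_remainder ip d n" using cholesky_remainder by blast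
  show ?thesis
    by (simp add: functional_def cholesky_functional_def P.ip_simps add_divide_distrib)
qed

lemma cmod_cholesky_functional_le: "(cmod (cholesky_functional ip d n x))\<^sup>2 \<le> Re (ip x x)"
  using cholesky_remainder_antimono[of 0 n d x] cholesky_remainder[of d "Suc n"]
  unfolding cmod_cholesky_functional by (smt (verit) cholesky_remainder.simps(1) le0)

end

end

section \<open>Traces of positive forms through square summable functionals\<close>

context hilbert_space
begin

text \<open>The remainders must tend to zero at every \<open>x\<close>. From step
  \<open>k + 1\<close> on the remainder seminorm vanishes at \<open>d k\<close>, so at
  \<open>x\<close> it is at most its value at \<open>x - d k\<close>, which \<open>p\<close> and
  hence \<open>C\<close> control uniformly in \<open>n\<close>.\<close>

lemma cholesky_sums:
  assumes p: "hermitian_space scl p" and nonneg: "\<And>x. 0 \<le> Re (p x x)"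
    and C: "\<And>x. Re (p x x) \<le> C * (nrm x)\<^sup>2"
    and dense: "\<And>x e. e > 0 \<Longrightarrow> \<exists>n. nrm (x - d n) < e"
  shows "(\<lambda>n. (cmod (cholesky_functional p d n x))\<^sup>2) sums Re (p x x)"
proof -
  interpret p: hermitian_space scl p by (rule p)
  let ?R = "cholesky_remainder p d"
  have "(\<lambda>n. Re (?R n x x)) \<longlonglongrightarrow> 0"
  proof (rule LIMSEQ_I)
    fix e :: real assume "e > 0"
    define \<delta> where "\<delta> = sqrt (e / (\<bar>C\<bar> + 1))"
    have "\<delta> > 0" using \<open>e > 0\<close> by (simp add: \<delta>_def)
    then obtain k where k: "nrm (x - d k) < \<delta>" using dense by blast
    have "Re (?R n x x) < e" if "Suc k \<le> n" for n
    proof -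
      interpret R: hermitian_space scl "?R n" using p.cholesky_remainder[OF nonneg] by blast
      have R_nn: "0 \<le> Re (?R n y y)" for y using p.cholesky_remainder[OF nonneg] by blast
      have "form_norm (?R n) x \<le> form_norm (?R n) (x - d k) + form_norm (?R n) (d k)"
        using R.form_norm_triangle_on[of UNIV "x - d k" "d k"] R_nn by simp
      also have "form_norm (?R n) (d k) = 0"
        using R.form_norm_square[OF R_nn, of "d k"] p.cholesky_remainder_vanishes[OF nonneg, of k n d]
          that by simp
      finally have "(form_norm (?R n) x)\<^sup>2 \<le> (form_norm (?R n) (x - d k))\<^sup>2"
        by (intro power_mono) simp_all
      then have "Re (?R n x x) \<le> Re (?R n (x - d k) (x - d k))"
        by (simp add: R.form_norm_square R_nn)
      also have "\<dots> \<le> Re (p (x - d k) (x - d k))"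
        using p.cholesky_remainder_antimono[OF nonneg, of 0 n d] by simp
      also have "\<dots> \<le> C * (nrm (x - d k))\<^sup>2" by (rule C)
      also have "\<dots> \<le> (\<bar>C\<bar> + 1) * (nrm (x - d k))\<^sup>2" by (intro mult_right_mono) auto
      also have "\<dots> < (\<bar>C\<bar> + 1) * \<delta>\<^sup>2"
        using k by (intro mult_strict_left_mono power_strict_mono) auto
      also have "\<dots> = e" using \<open>e > 0\<close> by (simp add: \<delta>_def)
      finally show ?thesis .
    qed
    then show "\<exists>N. \<forall>n\<ge>N. norm (Re (?R n x x) - 0) < e"
      using p.cholesky_remainder[OF nonneg] by (intro exI[of _ "Suc k"]) simp
  qed
  then have "(\<lambda>n. Re (p x x) - Re (?R n x x)) \<longlonglongrightarrow> Re (p x x) - 0" by (intro tendsto_intros)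
  then show ?thesis
    unfolding sums_def p.sum_cholesky_functional[OF nonneg] by simp
qed

text \<open>Parseval turns the trace of each squared functional into the squared norm of its
  representing vector \<open>k n\<close>; after exchanging sums, the finite trace over the single
  basis \<open>E\<close> becomes summability of \<open>(nrm (k n))\<^sup>2\<close>. The conclusion
  no longer mentions a basis.\<close>

lemma trace_class_form_decomposition:
  assumes p: "hermitian_space scl p" and nonneg: "\<And>x. 0 \<le> Re (p x x)"
    and C: "\<And>x. Re (p x x) \<le> C * (nrm x)\<^sup>2"
    and dense: "\<And>x e. e > 0 \<Longrightarrow> \<exists>n::nat. nrm (x - d n) < e"
    and E: "orthonormal_basis g E" and tr: "(\<lambda>e. Re (p e e)) summable_on E"
  shows "\<exists>\<phi> c. (\<forall>n::nat. functional scl (\<phi> n) \<and> 0 \<le> c n \<and> (\<forall>x. cmod (\<phi> n x) \<le> c n * nrm x)) \<and>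
    summable (\<lambda>n. (c n)\<^sup>2) \<and> (\<forall>x. (\<lambda>n. (cmod (\<phi> n x))\<^sup>2) sums Re (p x x))"
proof -
  interpret p: hermitian_space scl p by (rule p)
  define \<phi> where "\<phi> = cholesky_functional p d"
  have \<phi>: "functional scl (\<phi> n)" for n
    unfolding \<phi>_def by (rule p.functional_cholesky[OF nonneg])
  have sums: "(\<lambda>n. (cmod (\<phi> n x))\<^sup>2) sums Re (p x x)" for x
    unfolding \<phi>_def by (rule cholesky_sums[OF p nonneg C dense])
  have "cmod (\<phi> n x) \<le> sqrt \<bar>C\<bar> * nrm x" for n x
  proof (rule power2_le_imp_le)
    have "(cmod (\<phi> n x))\<^sup>2 \<le> C * (nrm x)\<^sup>2"
      unfolding \<phi>_def using p.cmod_cholesky_functional_le[OF nonneg] C order_trans by blast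
    also have "\<dots> \<le> \<bar>C\<bar> * (nrm x)\<^sup>2" by (intro mult_right_mono) auto
    finally show "(cmod (\<phi> n x))\<^sup>2 \<le> (sqrt \<bar>C\<bar> * nrm x)\<^sup>2" by (simp add: power_mult_distrib)
  qed simp
  then have "\<forall>n. \<exists>z. \<forall>x. \<phi> n x = g x z" using Riesz[OF \<phi>] by blast
  then obtain k where k: "\<And>n x. \<phi> n x = g x (k n)" by metis
  have "(\<lambda>n. (nrm (k n))\<^sup>2) summable_on UNIV"
  proof (rule summable_exchange_nonneg[OF _ _ tr])
    show "((\<lambda>n. (cmod (\<phi> n e))\<^sup>2) has_sum Re (p e e)) UNIV" for e
      by (rule sums_nonneg_imp_has_sum[OF sums]) simp
    show "((\<lambda>e. (cmod (\<phi> n e))\<^sup>2) has_sum (nrm (k n))\<^sup>2) E" for n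
      using Parseval[OF E, of "k n"] by (simp add: k cmod_ip_commute)
  qed simp
  then have "summable (\<lambda>n. (nrm (k n))\<^sup>2)" by (rule summable_on_imp_summable)
  moreover have "cmod (\<phi> n x) \<le> nrm (k n) * nrm x" for n x
    using cmod_ip_le[of x "k n"] by (simp add: k mult.commute)
  ultimately show ?thesis
    using \<phi> sums by (intro exI[of _ \<phi>] exI[of _ "\<lambda>n. nrm (k n)"]) auto
qed

text \<open>The common value is the sum of the squared norms of the representing vectors, an
  expression free of \<open>E\<close>. The hypotheses speak of bounds \<open>c n\<close> because
  representing vectors depend on the inner product, while bounds carry over up to a factor.\<close>

lemma trace_of_sum_of_squares:
  fixes \<psi> :: "nat \<Rightarrow> 'a \<Rightarrow> complex"
  assumes \<psi>: "\<And>n. functional scl (\<psi> n)" and c: "\<And>n x. cmod (\<psi> n x) \<le> c n * nrm x" "\<And>n. 0 \<le> c n"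
    and summable: "summable (\<lambda>n. (c n)\<^sup>2)"
    and Q: "\<And>x. (\<lambda>n. (cmod (\<psi> n x))\<^sup>2) sums Q x"
  shows "\<exists>t. \<forall>E. orthonormal_basis g E \<longrightarrow> (Q has_sum t) E"
proof -
  have "\<forall>n. \<exists>z. \<forall>x. \<psi> n x = g x z" using Riesz[OF \<psi> c(1)] by blast
  then obtain k where k: "\<And>n x. \<psi> n x = g x (k n)" by metis
  have k_le: "nrm (k n) \<le> c n" for n
    using nrm_le_of_ip_bound[of "k n" "c n"] c by (simp add: k)
  have "summable (\<lambda>n. (nrm (k n))\<^sup>2)"
    by (rule summable_comparison_test'[OF summable, of 0]) (simp add: k_le power_mono)
  then have t: "((\<lambda>n. (nrm (k n))\<^sup>2) has_sum (\<Sum>n. (nrm (k n))\<^sup>2)) UNIV"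
    by (intro sums_nonneg_imp_has_sum summable_sums) auto
  have "(Q has_sum (\<Sum>n. (nrm (k n))\<^sup>2)) E" if E: "orthonormal_basis g E" for E
  proof (rule has_sum_exchange_nonneg[OF _ _ t])
    show "((\<lambda>e. (cmod (\<psi> n e))\<^sup>2) has_sum (nrm (k n))\<^sup>2) E" for n
      using Parseval[OF E, of "k n"] by (simp add: k cmod_ip_commute)
    show "((\<lambda>n. (cmod (\<psi> n e))\<^sup>2) has_sum Q e) UNIV" for e
      by (rule sums_nonneg_imp_has_sum[OF Q]) simp
  qed simp
  then show ?thesis by blast
qed

end

section \<open>Krein spaces\<close>

locale signature_space = hermitian_space scl ip
  for scl :: "complex \<Rightarrow> 'a::ab_group_add \<Rightarrow> 'a" and ip :: "'a \<Rightarrow> 'a \<Rightarrow> complex" +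
  fixes J :: "'a \<Rightarrow> 'a"
  assumes signature: "signature_operator scl ip J"
begin

abbreviation ipJ :: "'a \<Rightarrow> 'a \<Rightarrow> complex" where "ipJ \<equiv> signature_ip ip J"

text \<open>With the projections \<open>P\<close> and \<open>Q\<close> one has
  \<open>[J x, y] = [P x, P y] - [Q x, Q y]\<close>. Symmetry and positivity can be read off, and
  completeness is inherited from the two summands.\<close>

lemma signature_structure:
  "hilbert_space scl ipJ" "\<And>x. J (J x) = x" "\<And>x y. ip (J x) y = ip x (J y)"
proof -
  obtain Hp Hm where fd: "fundamental_decomposition scl ip Hp Hm"
    and J: "\<And>u v. u \<in> Hp \<Longrightarrow> v \<in> Hm \<Longrightarrow> J (u + v) = u - v"
    using signature unfolding signature_operator_def by blast
  have p: "hilbert_on scl ip Hp" and m: "hilbert_on scl (\<lambda>x y. - ip x y) Hm"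
    and orth: "\<And>u v. u \<in> Hp \<Longrightarrow> v \<in> Hm \<Longrightarrow> ip u v = 0"
    and int: "Hp \<inter> Hm = {0}" and dec: "\<And>x. \<exists>u\<in>Hp. \<exists>v\<in>Hm. x = u + v"
    using fd unfolding fundamental_decomposition_def by blast+
  have sub: "subspace Hp" "subspace Hm" using p m by (simp_all add: hilbert_on_def)
  interpret m: hermitian_space scl "\<lambda>x y. - ip x y" using m by (simp add: hilbert_on_def)
  obtain P where P: "\<And>x. P x \<in> Hp" and P': "\<And>x. \<exists>v\<in>Hm. x = P x + v" using dec by metis
  define Q where "Q x = x - P x" for x
  have Q: "Q x \<in> Hm" for x using P'[of x] unfolding Q_def by (metis add_diff_cancel_left')
  have PQ: "x = P x + Q x" for x by (simp add: Q_def)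
  have unique: "P (u + v) = u" if "u \<in> Hp" "v \<in> Hm" for u v
  proof -
    have "P (u + v) + Q (u + v) = u + v" using PQ by simp
    then have "P (u + v) - u = v - Q (u + v)" by (simp add: algebra_simps)
    moreover have "P (u + v) - u \<in> Hp" "v - Q (u + v) \<in> Hm"
      using sub P Q that by (simp_all add: subspace_diff)
    ultimately have "P (u + v) - u \<in> Hp \<inter> Hm" by simp
    then show ?thesis using int by simp
  qed
  have P_diff: "P (x - y) = P x - P y" for x y
  proof -
    have "P ((P x - P y) + (Q x - Q y)) = P x - P y"
      by (rule unique) (use sub P Q in \<open>simp_all add: subspace_diff\<close>)
    then show ?thesis by (simp add: Q_def)
  qed
  have Q_diff: "Q (x - y) = Q x - Q y" for x y by (simp add: Q_def P_diff)
  have JPQ: "J x = P x - Q x" for x using J[OF P Q, of x x] PQ by simp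
  show JJ: "J (J x) = x" for x
  proof -
    have "J (P x + (- Q x)) = P x - (- Q x)"
      by (rule J) (use P Q sub in \<open>simp_all add: subspace_neg\<close>)
    then show ?thesis using PQ[of x] by (simp add: JPQ[of x])
  qed
  have orth': "ip u v = 0" if "u \<in> Hm" "v \<in> Hp" for u v
    using orth[OF that(2,1)] ip_commute[of u v] by simp
  have ipJ: "ip (J x) y = ip (P x) (P y) - ip (Q x) (Q y)" for x y
    by (subst PQ[of y]) (simp add: JPQ ip_simps orth[OF P Q] orth'[OF Q P])
  show sym: "ip (J x) y = ip x (J y)" for x y
    unfolding ipJ by (subst PQ[of x]) (simp add: JPQ ip_simps orth[OF P Q] orth'[OF Q P])
  have P_pos: "P x \<noteq> 0 \<Longrightarrow> 0 < Re (ip (P x) (P x))" and Q_pos: "Q x \<noteq> 0 \<Longrightarrow> 0 < - Re (ip (Q x) (Q x))"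
    for x
    using p m P[of x] Q[of x] by (auto simp: hilbert_on_def less_complex_def)
  have P_nn: "0 \<le> Re (ip (P x) (P x))" and Q_nn: "0 \<le> - Re (ip (Q x) (Q x))" for x
    using P_pos[of x] Q_pos[of x] by (cases "P x = 0"; cases "Q x = 0"; simp)+
  interpret J: hermitian_space scl ipJ
  proof unfold_locales
    fix c x y z
    show "ipJ (x + y) z = ipJ x z + ipJ y z" "ipJ (scl c x) y = c * ipJ x y"
      by (simp_all add: signature_ip_def sym ip_simps)
    show "ipJ x y = cnj (ipJ y x)"
      by (metis signature_ip_def sym ip_commute)
  qed
  have pos: "0 < Re (ipJ x x)" if "x \<noteq> 0" for x
  proof -
    have "P x \<noteq> 0 \<or> Q x \<noteq> 0" using that PQ[of x] by auto
    then show ?thesis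
      using P_pos[of x] Q_pos[of x] P_nn[of x] Q_nn[of x] by (auto simp: signature_ip_def ipJ)
  qed
  have nn: "0 \<le> Re (ipJ x x)" for x using pos[of x] by (cases "x = 0") auto
  \<comment> \<open>Pythagoras: the components of a Cauchy sequence are Cauchy, and their limits add
    up to its limit.\<close>
  have norm_split: "(form_norm ipJ x)\<^sup>2 =
      (form_norm ip (P x))\<^sup>2 + (form_norm (\<lambda>x y. - ip x y) (Q x))\<^sup>2" for x
    using J.form_norm_square[OF nn, of x] form_norm_square[OF P_nn, of x]
      m.form_norm_square[of "Q x"] Q_nn[of x]
    by (simp add: signature_ip_def ipJ)
  show "hilbert_space scl ipJ"
  proof unfold_locales
    show "0 < Re (ipJ x x)" if "x \<noteq> 0" for x by (rule pos[OF that])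
  next
    fix X :: "nat \<Rightarrow> 'a"
    assume X: "\<And>e. e > 0 \<Longrightarrow> \<exists>N. \<forall>m\<ge>N. \<forall>n\<ge>N. form_norm ipJ (X m - X n) < e"
    have le: "form_norm ip (P x) \<le> form_norm ipJ x"
      "form_norm (\<lambda>x y. - ip x y) (Q x) \<le> form_norm ipJ x" for x
      by (rule power2_le_imp_le; simp add: norm_split)+
    have "\<exists>l\<in>Hp. (\<lambda>n. form_norm ip (P (X n) - l)) \<longlonglongrightarrow> 0"
    proof (rule hilbert_on_complete[OF p P])
      fix e :: real assume "e > 0"
      from X[OF this] obtain N where
        "\<And>m n. m \<ge> N \<Longrightarrow> n \<ge> N \<Longrightarrow> form_norm ipJ (X m - X n) < e" by blast
      then show "\<exists>N. \<forall>m\<ge>N. \<forall>n\<ge>N. form_norm ip (P (X m) - P (X n)) < e"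
        unfolding P_diff[symmetric] using order_le_less_trans[OF le(1)] by blast
    qed
    then obtain l1 where l1: "l1 \<in> Hp" "(\<lambda>n. form_norm ip (P (X n) - l1)) \<longlonglongrightarrow> 0" by blast
    have "\<exists>l\<in>Hm. (\<lambda>n. form_norm (\<lambda>x y. - ip x y) (Q (X n) - l)) \<longlonglongrightarrow> 0"
    proof (rule hilbert_on_complete[OF m Q])
      fix e :: real assume "e > 0"
      from X[OF this] obtain N where
        "\<And>m n. m \<ge> N \<Longrightarrow> n \<ge> N \<Longrightarrow> form_norm ipJ (X m - X n) < e" by blast
      then show "\<exists>N. \<forall>m\<ge>N. \<forall>n\<ge>N. form_norm (\<lambda>x y. - ip x y) (Q (X m) - Q (X n)) < e"
        unfolding Q_diff[symmetric] using order_le_less_trans[OF le(2)] by blast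
    qed
    then obtain l2 where l2: "l2 \<in> Hm" "(\<lambda>n. form_norm (\<lambda>x y. - ip x y) (Q (X n) - l2)) \<longlonglongrightarrow> 0"
      by blast
    have Pl: "P (l1 + l2) = l1" using unique[OF l1(1) l2(1)] .
    then have Ql: "Q (l1 + l2) = l2" by (simp add: Q_def)
    define a where "a n = form_norm ip (P (X n) - l1)" for n
    define b where "b n = form_norm (\<lambda>x y. - ip x y) (Q (X n) - l2)" for n
    have "(form_norm ipJ (X n - (l1 + l2)))\<^sup>2 = (a n)\<^sup>2 + (b n)\<^sup>2" for n
      unfolding norm_split P_diff Q_diff Pl Ql a_def b_def ..
    then have "form_norm ipJ (X n - (l1 + l2)) = sqrt ((a n)\<^sup>2 + (b n)\<^sup>2)" for n
      by (intro real_sqrt_unique[symmetric]) simp_all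
    moreover have "a \<longlonglongrightarrow> 0" "b \<longlonglongrightarrow> 0"
      using l1(2) l2(2) by (simp_all add: a_def[abs_def] b_def[abs_def])
    then have "(\<lambda>n. sqrt ((a n)\<^sup>2 + (b n)\<^sup>2)) \<longlonglongrightarrow> sqrt (0\<^sup>2 + 0\<^sup>2)"
      by (intro tendsto_intros)
    ultimately have "(\<lambda>n. form_norm ipJ (X n - (l1 + l2))) \<longlonglongrightarrow> 0" by simp
    then show "\<exists>l. (\<lambda>n. form_norm ipJ (X n - l)) \<longlonglongrightarrow> 0" by blast
  qed
qed

sublocale J: hilbert_space scl ipJ
  by (rule signature_structure)

lemma J_J [simp]: "J (J x) = x"
  by (rule signature_structure)

lemma ip_J: "ip (J x) y = ip x (J y)"
  by (rule signature_structure)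

lemma ip_eq_ipJ: "ip x y = ipJ x (J y)"
  by (simp add: signature_ip_def ip_J)

lemma nrm_J [simp]: "form_norm ipJ (J x) = form_norm ipJ x"
  by (simp add: form_norm_def signature_ip_def ip_J)

lemma cmod_ip_le_nrm: "cmod (ip x y) \<le> form_norm ipJ x * form_norm ipJ y"
  using J.cmod_ip_le[of x "J y"] by (simp add: ip_eq_ipJ)

lemma ip_nondegenerate: "(\<And>x. ip x y = ip x z) \<Longrightarrow> y = z"
  by (metis J.ip_right_eqI J_J ip_eq_ipJ)

lemma J_linear: "Vector_Spaces.linear scl scl J"
proof -
  have "J (x + y) = J x + J y" for x y
    by (rule ip_nondegenerate) (simp add: ip_simps flip: ip_J)
  moreover have "J (scl c x) = scl c (J x)" for c x
    by (rule ip_nondegenerate) (simp add: ip_simps flip: ip_J)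
  ultimately show ?thesis
    by unfold_locales auto
qed

end

text \<open>The functionals \<open>[\<cdot>, x]\<close> with \<open>x\<close> in the unit ball of one signature norm are pointwise
  bounded by the Cauchy-Schwarz inequality for that norm, hence uniformly bounded with respect to
  the other signature norm.\<close>

lemma signature_norm_equivalence:
  assumes "signature_space scl ip J" and "signature_space scl ip J'"
  shows "\<exists>C\<ge>0. \<forall>x. form_norm (signature_ip ip J) x \<le> C * form_norm (signature_ip ip J') x"
proof -
  interpret J: signature_space scl ip J by fact
  interpret J': signature_space scl ip J' by fact
  \<comment> \<open>\<open>J\<close> enters because \<open>[y, x]\<close> is the
    \<open>J\<close>-inner product of \<open>y\<close> and \<open>J x\<close>; it leaves the
    \<open>J\<close>-norm unchanged.\<close>
  have "\<exists>C. \<forall>y\<in>J ` {x. J'.J.nrm x \<le> 1}. J.J.nrm y \<le> C"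
  proof (rule J.J.weakly_bounded_imp_bounded)
    fix y
    have "cmod (J.ipJ y (J x)) \<le> J'.J.nrm y" if "J'.J.nrm x \<le> 1" for x
    proof -
      have "cmod (J.ipJ y (J x)) \<le> J'.J.nrm y * J'.J.nrm x"
        using J'.cmod_ip_le_nrm[of y x] by (simp add: J.ip_eq_ipJ)
      also have "\<dots> \<le> J'.J.nrm y" using that by (simp add: mult_left_le)
      finally show ?thesis .
    qed
    then show "\<exists>C. \<forall>z\<in>J ` {x. J'.J.nrm x \<le> 1}. cmod (J.ipJ y z) \<le> C" by blast
  qed
  then obtain C where C: "\<And>x. J'.J.nrm x \<le> 1 \<Longrightarrow> J.J.nrm x \<le> C" by force
  have "0 \<le> C" using C[of 0] by simp
  have "J.J.nrm x \<le> C * J'.J.nrm x" for x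
  proof (cases "x = 0")
    case False
    have "J.J.nrm (scl (of_real (1 / J'.J.nrm x)) x) \<le> C"
      by (rule C) (simp only: J'.J.nrm_normalize[OF False])
    then show ?thesis
      using J'.J.nrm_pos[OF False] unfolding J.J.nrm_scale_real by (simp add: field_simps)
  qed simp
  then show ?thesis using \<open>0 \<le> C\<close> by blast
qed

lemma ex_signature_operator:
  assumes "krein_space scl ip"
  shows "\<exists>J. signature_operator scl ip J"
proof -
  interpret krein_space scl ip by fact
  obtain Hp Hm where fd: "fundamental_decomposition scl ip Hp Hm"
    using ex_fundamental_decomposition by blast
  then have sub: "subspace Hp" "subspace Hm" and int: "Hp \<inter> Hm = {0}"
    by (simp_all add: fundamental_decomposition_def hilbert_on_def)
  have "\<exists>u v. x = u + v \<and> u \<in> Hp \<and> v \<in> Hm" for x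
    using fd unfolding fundamental_decomposition_def by blast
  then obtain P Q where PQ: "\<And>x. x = P x + Q x" "\<And>x. P x \<in> Hp" "\<And>x. Q x \<in> Hm" by metis
  have "P (u + v) - Q (u + v) = u - v" if "u \<in> Hp" "v \<in> Hm" for u v
  proof -
    have eq: "P (u + v) - u = v - Q (u + v)" using PQ(1)[of "u + v"] by (simp add: algebra_simps)
    have "P (u + v) - u \<in> Hp" "v - Q (u + v) \<in> Hm"
      using sub PQ that by (simp_all add: subspace_diff)
    then have "P (u + v) - u \<in> Hp \<inter> Hm" unfolding eq by simp
    then have "P (u + v) - u = 0" using int by simp
    moreover from this have "v - Q (u + v) = 0" unfolding eq .
    ultimately show ?thesis by simp
  qed
  then have "signature_operator scl ip (\<lambda>x. P x - Q x)"
    using fd unfolding signature_operator_def by blast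
  then show ?thesis by blast
qed

section \<open>Bounded operators between Krein spaces and their adjoints\<close>

text \<open>\<open>bounded_op\<close> allows a negative constant; chaining two bounds calls for a
  nonnegative one.\<close>

lemma bounded_op_nonneg_bound:
  assumes "bounded_op s1 g1 s2 g2 T" and "\<And>x. 0 \<le> form_norm g1 x"
  obtains C where "0 \<le> C" "\<And>x. form_norm g2 (T x) \<le> C * form_norm g1 x"
proof -
  obtain C where C: "\<And>x. form_norm g2 (T x) \<le> C * form_norm g1 x"
    using assms(1) by (auto simp: bounded_op_def)
  have "form_norm g2 (T x) \<le> \<bar>C\<bar> * form_norm g1 x" for x
    using C[of x] mult_right_mono[OF abs_ge_self[of C] assms(2)[of x]] by linarith
  then show ?thesis using that[of "\<bar>C\<bar>"] by simp
qed

text \<open>Equivalence of signature norms on both sides replaces the signature operators hidden in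
  \<open>krein_operators\<close> by prescribed ones. Compositions and differences rest on this,
  since two operators may come with different witnesses.\<close>

lemma krein_operators_iff:
  assumes J1: "signature_space scl1 ip1 J1" and J2: "signature_space scl2 ip2 J2"
  shows "T \<in> krein_operators scl1 ip1 scl2 ip2 \<longleftrightarrow>
    bounded_op scl1 (signature_ip ip1 J1) scl2 (signature_ip ip2 J2) T"
proof
  interpret J1: signature_space scl1 ip1 J1 by fact
  interpret J2: signature_space scl2 ip2 J2 by fact
  assume "T \<in> krein_operators scl1 ip1 scl2 ip2"
  then obtain J1' J2' where s: "signature_operator scl1 ip1 J1'" "signature_operator scl2 ip2 J2'"
    and T: "bounded_op scl1 (signature_ip ip1 J1') scl2 (signature_ip ip2 J2') T"
    by (auto simp: krein_operators_def)
  interpret J1': signature_space scl1 ip1 J1' by unfold_locales (rule s)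
  interpret J2': signature_space scl2 ip2 J2' by unfold_locales (rule s)
  obtain C where C: "0 \<le> C" "\<And>x. J2'.J.nrm (T x) \<le> C * J1'.J.nrm x"
    using bounded_op_nonneg_bound[OF T] by auto
  obtain C1 where C1: "\<And>x. J1'.J.nrm x \<le> C1 * J1.J.nrm x"
    using signature_norm_equivalence[OF J1'.signature_space_axioms J1] by blast
  obtain C2 where C2: "0 \<le> C2" "\<And>x. J2.J.nrm x \<le> C2 * J2'.J.nrm x"
    using signature_norm_equivalence[OF J2 J2'.signature_space_axioms] by blast
  have "J2.J.nrm (T x) \<le> C2 * (C * (C1 * J1.J.nrm x))" for x
    using C2(2)[of "T x"] mult_left_mono[OF C(2)[of x] C2(1)]
      mult_left_mono[OF mult_left_mono[OF C1[of x] C(1)] C2(1)] by linarith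
  then have "\<exists>C. \<forall>x. J2.J.nrm (T x) \<le> C * J1.J.nrm x"
    by (intro exI[of _ "C2 * C * C1"]) (simp add: mult.assoc)
  then show "bounded_op scl1 (signature_ip ip1 J1) scl2 (signature_ip ip2 J2) T"
    using T by (simp add: bounded_op_def)
qed (use assms in \<open>auto simp: krein_operators_def signature_space_def signature_space_axioms_def\<close>)

lemma krein_operators_compose:
  assumes J1: "signature_space scl1 ip1 J1" and J2: "signature_space scl2 ip2 J2"
    and J3: "signature_space scl3 ip3 J3"
    and S: "S \<in> krein_operators scl1 ip1 scl2 ip2" and T: "T \<in> krein_operators scl2 ip2 scl3 ip3"
  shows "(\<lambda>x. T (S x)) \<in> krein_operators scl1 ip1 scl3 ip3"
proof -
  interpret J1: signature_space scl1 ip1 J1 by fact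
  interpret J2: signature_space scl2 ip2 J2 by fact
  have S': "bounded_op scl1 J1.ipJ scl2 J2.ipJ S"
    using S krein_operators_iff[OF J1 J2] by blast
  have T': "bounded_op scl2 J2.ipJ scl3 (signature_ip ip3 J3) T"
    using T krein_operators_iff[OF J2 J3] by blast
  obtain B where B: "\<And>x. J2.J.nrm (S x) \<le> B * J1.J.nrm x"
    using S' by (auto simp: bounded_op_def)
  obtain C where C: "0 \<le> C" "\<And>x. form_norm (signature_ip ip3 J3) (T x) \<le> C * J2.J.nrm x"
    using bounded_op_nonneg_bound[OF T'] by auto
  have "Vector_Spaces.linear scl1 scl3 (T \<circ> S)"
    using S' T' by (intro Vector_Spaces.linear_compose) (auto simp: bounded_op_def)
  moreover have "form_norm (signature_ip ip3 J3) (T (S x)) \<le> (C * B) * J1.J.nrm x" for x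
    using C(2)[of "S x"] mult_left_mono[OF B[of x] C(1)] by (simp add: mult.assoc)
  ultimately have "bounded_op scl1 J1.ipJ scl3 (signature_ip ip3 J3) (\<lambda>x. T (S x))"
    by (auto simp: bounded_op_def o_def)
  then show ?thesis using krein_operators_iff[OF J1 J3] by blast
qed

lemma krein_operators_diff:
  assumes J1: "signature_space scl1 ip1 J1" and J2: "signature_space scl2 ip2 J2"
    and S: "S \<in> krein_operators scl1 ip1 scl2 ip2" and T: "T \<in> krein_operators scl1 ip1 scl2 ip2"
  shows "(\<lambda>x. S x - T x) \<in> krein_operators scl1 ip1 scl2 ip2"
proof -
  interpret J1: signature_space scl1 ip1 J1 by fact
  interpret J2: signature_space scl2 ip2 J2 by fact
  have S': "bounded_op scl1 J1.ipJ scl2 J2.ipJ S" and T': "bounded_op scl1 J1.ipJ scl2 J2.ipJ T"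
    using S T krein_operators_iff[OF J1 J2] by blast+
  interpret S: Vector_Spaces.linear scl1 scl2 S using S' by (simp add: bounded_op_def)
  interpret T: Vector_Spaces.linear scl1 scl2 T using T' by (simp add: bounded_op_def)
  obtain B C where B: "\<And>x. J2.J.nrm (S x) \<le> B * J1.J.nrm x"
    and C: "\<And>x. J2.J.nrm (T x) \<le> C * J1.J.nrm x"
    using S' T' by (auto simp: bounded_op_def)
  have "Vector_Spaces.linear scl1 scl2 (\<lambda>x. S x - T x)"
    by unfold_locales
      (simp_all add: S.add T.add S.scale T.scale J2.scale_right_diff_distrib)
  moreover have "J2.J.nrm (S x - T x) \<le> (B + C) * J1.J.nrm x" for x
    using J2.J.nrm_diff_le[of "S x" "T x"] B[of x] C[of x] by (simp add: distrib_right)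
  ultimately have "bounded_op scl1 J1.ipJ scl2 J2.ipJ (\<lambda>x. S x - T x)"
    by (auto simp: bounded_op_def)
  then show ?thesis using krein_operators_iff[OF J1 J2] by blast
qed

context hilbert_space
begin

text \<open>Riesz gives existence and definiteness uniqueness, so the description in
  \<open>form_adjoint\<close> does denote the adjoint.\<close>

lemma ip_form_adjoint:
  assumes "bounded_op scl g scl g T"
  shows "g (T x) y = g x (form_adjoint g g T y)"
proof -
  interpret T: Vector_Spaces.linear scl scl T using assms by (simp add: bounded_op_def)
  obtain C where C: "\<And>x. nrm (T x) \<le> C * nrm x" using assms by (auto simp: bounded_op_def)
  have "\<exists>z. \<forall>x. g (T x) y = g x z" for y
  proof (rule Riesz)
    show "functional scl (\<lambda>x. g (T x) y)"
      by (simp add: functional_def T.add T.scale ip_simps)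
    show "cmod (g (T x) y) \<le> (C * nrm y) * nrm x" for x
      using cmod_ip_le[of "T x" y] mult_right_mono[OF C[of x], of "nrm y"] by (simp add: mult_ac)
  qed
  then obtain S where S: "\<And>x y. g (T x) y = g x (S y)" by metis
  have "\<forall>x y. g (T x) y = g x (form_adjoint g g T y)"
    unfolding form_adjoint_def
  proof (rule theI[of "\<lambda>S. \<forall>x y. g (T x) y = g x (S y)"])
    show "\<forall>x y. g (T x) y = g x (S y)" using S by blast
    show "S' = S" if "\<forall>x y. g (T x) y = g x (S' y)" for S'
      using that S by (intro ext ip_right_eqI) simp
  qed
  then show ?thesis by blast
qed

end

lemma (in signature_space) ip_krein_adjoint:
  assumes "T \<in> krein_operators scl ip scl ip"
  shows "ip (T x) y = ip x (form_adjoint ip ip T y)"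
proof -
  have T: "bounded_op scl ipJ scl ipJ T"
    using assms krein_operators_iff signature_space_axioms by blast
  \<comment> \<open>The Krein adjoint is \<open>J T' J\<close> with \<open>T'\<close> the adjoint in
    the \<open>J\<close>-inner product.\<close>
  define S where "S y = J (form_adjoint ipJ ipJ T (J y))" for y
  have S: "ip (T x) y = ip x (S y)" for x y
    using J.ip_form_adjoint[OF T, of x "J y"] by (simp add: S_def ip_eq_ipJ)
  have "\<forall>x y. ip (T x) y = ip x (form_adjoint ip ip T y)"
    unfolding form_adjoint_def
  proof (rule theI[of "\<lambda>S. \<forall>x y. ip (T x) y = ip x (S y)"])
    show "\<forall>x y. ip (T x) y = ip x (S y)" using S by blast
    show "S' = S" if "\<forall>x y. ip (T x) y = ip x (S' y)" for S'
      using that S by (intro ext ip_nondegenerate) simp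
  qed
  then show ?thesis by blast
qed

lemma krein_separable_dense_sequence:
  assumes J: "signature_space scl ip J" and sep: "krein_separable scl ip"
  shows "\<exists>d::nat \<Rightarrow> _. \<forall>x. \<forall>e>0. \<exists>n. form_norm (signature_ip ip J) (x - d n) < e"
proof -
  interpret J: signature_space scl ip J by fact
  obtain J' where s: "signature_operator scl ip J'"
    and sep': "separable_space (Metric_space.mtopology UNIV (form_dist (signature_ip ip J')))"
    using sep by (auto simp: krein_separable_def)
  interpret J': signature_space scl ip J' by unfold_locales (rule s)
  interpret M: Metric_space UNIV "form_dist J'.ipJ"
  proof
    fix x y z
    show "form_dist J'.ipJ x z \<le> form_dist J'.ipJ x y + form_dist J'.ipJ y z"
      unfolding form_dist_def by (rule J'.J.nrm_triangle_diff)
  qed (simp_all add: form_dist_def J'.J.form_norm_minus_commute)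
  obtain U where U: "countable U" "M.mtopology closure_of U = UNIV"
    using sep' by (auto simp: separable_space_def)
  have dense: "\<exists>u\<in>U. J'.J.nrm (x - u) < e" if "e > 0" for x e
  proof -
    have "x \<in> M.mtopology closure_of U" using U by simp
    then have "\<exists>u\<in>U. u \<in> M.mball x e"
      using that unfolding M.metric_closure_of by blast
    then show ?thesis by (auto simp: M.in_mball form_dist_def)
  qed
  have "U \<noteq> {}" using dense[of 1 0] by auto
  then have d: "range (from_nat_into U) = U" using U(1) by (rule range_from_nat_into)
  obtain C where C: "0 \<le> C" "\<And>x. J.J.nrm x \<le> C * J'.J.nrm x"
    using signature_norm_equivalence[OF J J'.signature_space_axioms] by blast
  have "\<exists>n. J.J.nrm (x - from_nat_into U n) < e" if "e > 0" for x e
  proof -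
    obtain u where u: "u \<in> U" "J'.J.nrm (x - u) < e / (C + 1)"
      using dense[of "e / (C + 1)" x] \<open>e > 0\<close> C(1) by auto
    have "J.J.nrm (x - u) \<le> C * J'.J.nrm (x - u)" by (rule C)
    also have "\<dots> \<le> (C + 1) * J'.J.nrm (x - u)" by (simp add: mult_right_mono)
    also have "\<dots> < e" using u(2) C(1) by (simp add: field_simps)
    finally show ?thesis using u(1) d by (metis rangeE)
  qed
  then show ?thesis by blast
qed

section \<open>Trace class forms on Krein spaces\<close>

lemma krein_selfadjointD:
  assumes J: "signature_space scl ip J" and W: "W \<in> krein_selfadjoint scl ip"
  shows "W \<in> krein_operators scl ip scl ip" and "ip (W x) y = ip x (W y)"
proof -
  interpret J: signature_space scl ip J by fact
  show *: "W \<in> krein_operators scl ip scl ip" using W by (simp add: krein_selfadjoint_def)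
  have "W = form_adjoint ip ip W" using W by (simp add: krein_selfadjoint_def)
  then show "ip (W x) y = ip x (W y)" using J.ip_krein_adjoint[OF *, of x y] by simp
qed

lemma selfadjoint_form_hermitian:
  assumes J: "signature_space scl ip J" and W: "W \<in> krein_selfadjoint scl ip"
  shows "hermitian_space scl (\<lambda>x y. ip (W x) y)"
proof -
  interpret J: signature_space scl ip J by fact
  note W' = krein_selfadjointD[OF J W]
  interpret W: Vector_Spaces.linear scl scl W
    using W'(1) krein_operators_iff[OF J J] by (simp add: bounded_op_def)
  show ?thesis
    by unfold_locales (simp_all add: W.add W.scale J.ip_simps, metis W'(2) J.ip_commute)
qed

text \<open>\<open>J0\<close> carries the finite trace, \<open>J\<close> is the operator for which
  the trace is wanted. Viewing \<open>Y\<close> as bounded from the \<open>J\<close>-norm to the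
  \<open>J0\<close>-norm changes the norm and inserts \<open>Y\<close> in one stroke:
  \<open>\<phi> n\<close> composed with \<open>Y\<close> has the \<open>J\<close>-bound
  \<open>c n * B\<close>.\<close>

lemma positive_form_trace:
  assumes J0: "signature_space scl ip J0" and J: "signature_space scl ip J"
    and sep: "krein_separable scl ip"
    and p: "hermitian_space scl p" "\<And>x. 0 \<le> Re (p x x)"
    and C: "\<And>x. Re (p x x) \<le> C * (form_norm (signature_ip ip J0) x)\<^sup>2"
    and E0: "orthonormal_basis (signature_ip ip J0) E0" and tr: "(\<lambda>e. Re (p e e)) summable_on E0"
    and Y: "Y \<in> krein_operators scl ip scl ip"
  shows "\<exists>t. \<forall>E. orthonormal_basis (signature_ip ip J) E \<longrightarrow>
    ((\<lambda>e. Re (p (Y e) (Y e))) has_sum t) E"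
proof -
  interpret J0: signature_space scl ip J0 by fact
  interpret J: signature_space scl ip J by fact
  obtain d where d: "\<And>x e. e > 0 \<Longrightarrow> \<exists>n::nat. J0.J.nrm (x - d n) < e"
    using krein_separable_dense_sequence[OF J0 sep] by blast
  obtain \<phi> c where \<phi>: "\<And>n::nat. functional scl (\<phi> n)" and c: "\<And>n. 0 \<le> c n"
      "\<And>n x. cmod (\<phi> n x) \<le> c n * J0.J.nrm x" and summable: "summable (\<lambda>n. (c n)\<^sup>2)"
    and sums: "\<And>x. (\<lambda>n. (cmod (\<phi> n x))\<^sup>2) sums Re (p x x)"
    using J0.J.trace_class_form_decomposition[OF p C d E0 tr] by blast
  have Y': "bounded_op scl J.ipJ scl J0.ipJ Y" using Y krein_operators_iff[OF J J0] by blast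
  then interpret Y: Vector_Spaces.linear scl scl Y by (simp add: bounded_op_def)
  obtain B where B: "0 \<le> B" "\<And>x. J0.J.nrm (Y x) \<le> B * J.J.nrm x"
    using bounded_op_nonneg_bound[OF Y'] by auto
  show ?thesis
  proof (rule J.J.trace_of_sum_of_squares)
    show "functional scl (\<lambda>x. \<phi> n (Y x))" for n
      using \<phi>[of n] by (simp add: functional_def Y.add Y.scale)
    show "cmod (\<phi> n (Y x)) \<le> (c n * B) * J.J.nrm x" for n x
      using c(2)[of n "Y x"] mult_left_mono[OF B(2)[of x] c(1)[of n]] by (simp add: mult.assoc)
    show "summable (\<lambda>n. (c n * B)\<^sup>2)"
      using summable_mult2[OF summable, of "B\<^sup>2"] by (simp add: power_mult_distrib)
    show "(\<lambda>n. (cmod (\<phi> n (Y x)))\<^sup>2) sums Re (p (Y x) (Y x))" for x by (rule sums)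
  qed (simp add: c(1) B(1))
qed

text \<open>With \<open>R\<close> the absolute value of \<open>W\<close>, the form \<open>[W x, y]\<close> is half the difference of the
  positive forms \<open>\<langle>R x, y\<rangle> \<plusminus> [W x, y]\<close>.\<close>

theorem trace_class_form_trace:
  assumes J: "signature_space scl ip J" and sep: "krein_separable scl ip"
    and tc: "W \<in> krein_trace_class scl ip" and W: "W \<in> krein_selfadjoint scl ip"
    and Y: "Y \<in> krein_operators scl ip scl ip"
  shows "\<exists>t. \<forall>E. orthonormal_basis (signature_ip ip J) E \<longrightarrow>
    ((\<lambda>e. Re (ip (W (Y e)) (Y e))) has_sum t) E"
proof -
  interpret J: signature_space scl ip J by fact
  obtain J0 where J0: "signature_operator scl ip J0" and "trace_class scl (signature_ip ip J0) W"
    using tc by (auto simp: krein_trace_class_def)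
  then obtain R E0 where W_bdd: "bounded_op scl (signature_ip ip J0) scl (signature_ip ip J0) W"
    and R: "is_absolute_value scl (signature_ip ip J0) W R"
    and E0: "orthonormal_basis (signature_ip ip J0) E0"
    and tr: "(\<lambda>e. signature_ip ip J0 (R e) e) summable_on E0"
    by (auto simp: trace_class_def)
  interpret J0: signature_space scl ip J0 by unfold_locales (rule J0)
  have R_bdd: "bounded_op scl J0.ipJ scl J0.ipJ R" and R_pos: "\<And>x. 0 \<le> J0.ipJ (R x) x"
    and RR: "\<And>x. R (R x) = form_adjoint J0.ipJ J0.ipJ W (W x)"
    using R by (auto simp: is_absolute_value_def fun_eq_iff)
  interpret q: hermitian_space scl "\<lambda>x y. ip (W x) y" by (rule selfadjoint_form_hermitian[OF J W])
  have R_lin: "Vector_Spaces.linear scl scl R" and W_lin: "Vector_Spaces.linear scl scl W"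
    using R_bdd W_bdd by (simp_all add: bounded_op_def)
  interpret R: Vector_Spaces.linear scl scl R by (rule R_lin)
  interpret J0L: Vector_Spaces.linear scl scl J0 by (rule J0.J_linear)
  obtain C where C: "0 \<le> C" "\<And>x. J0.J.nrm (R x) \<le> C * J0.J.nrm x"
    using bounded_op_nonneg_bound[OF R_bdd] by auto
  have R_im: "Im (J0.ipJ (R x) x) = 0" for x
    using R_pos[of x] by (simp add: less_eq_complex_def)
  have R_sym: "J0.ipJ (R x) y = cnj (J0.ipJ (R y) x)" for x y
    by (rule J0.J.form_symmetric[OF R_lin R_im])
  have R_re: "0 \<le> Re (J0.ipJ (R x) x)" for x
    using R_pos[of x] by (simp add: less_eq_complex_def)
  have nrm_R: "J0.J.nrm (R x) = J0.J.nrm (W x)" for x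
  proof -
    have "J0.ipJ (R x) (R x) = cnj (J0.ipJ (R (R x)) x)" by (rule R_sym)
    also have "\<dots> = J0.ipJ x (form_adjoint J0.ipJ J0.ipJ W (W x))"
      unfolding RR by (metis J0.J.ip_commute)
    also have "\<dots> = J0.ipJ (W x) (W x)" by (rule J0.J.ip_form_adjoint[OF W_bdd, symmetric])
    finally show ?thesis by (simp add: form_norm_def)
  qed
  have W_im: "Im (ip (W x) x) = 0" for x by (rule q.Im_ip_self)
  \<comment> \<open>\<open>W\<close> is symmetric for the indefinite form; the operator representing
    \<open>[W x, y]\<close> in the \<open>J0\<close>-inner product is \<open>J0 W\<close>, which is
    symmetric there. As \<open>J0\<close> is an isometry, \<open>nrm_R\<close> allows both
    \<open>J0 W\<close> and its negative to be compared with \<open>R\<close>.\<close>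
  have JW: "J0.ipJ (J0 (W x)) y = ip (W x) y" for x y by (simp add: signature_ip_def)
  have le: "Re (ip (W x) x) \<le> Re (J0.ipJ (R x) x)" for x
  proof -
    have "Re (J0.ipJ (J0 (W x)) x) \<le> Re (J0.ipJ (R x) x)"
    proof (rule J0.J.quadratic_form_le_of_norm_le[OF _ R_lin C(2,1) _ R_pos])
      show "Vector_Spaces.linear scl scl (\<lambda>x. J0 (W x))"
        using Vector_Spaces.linear_compose[OF W_lin J0.J_linear] by (simp add: o_def)
    qed (simp_all add: JW W_im nrm_R)
    then show ?thesis by (simp add: JW)
  qed
  have ge: "- Re (ip (W x) x) \<le> Re (J0.ipJ (R x) x)" for x
  proof -
    interpret W: Vector_Spaces.linear scl scl W by (rule W_lin)
    have "Re (J0.ipJ (- J0 (W x)) x) \<le> Re (J0.ipJ (R x) x)"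
    proof (rule J0.J.quadratic_form_le_of_norm_le[OF _ R_lin C(2,1) _ R_pos])
      show "Vector_Spaces.linear scl scl (\<lambda>x. - J0 (W x))"
        by unfold_locales (simp_all add: W.add W.scale J0L.add J0L.scale)
    qed (simp_all add: JW W_im nrm_R J0.J.ip_minus_left J0.J.form_norm_minus)
    then show ?thesis by (simp add: JW J0.J.ip_minus_left)
  qed
  have tr_R: "(\<lambda>e. 2 * Re (J0.ipJ (R e) e)) summable_on E0"
    using tr by (intro summable_on_cmult_right summable_on_Re)
  have R_C: "Re (J0.ipJ (R x) x) \<le> C * (J0.J.nrm x)\<^sup>2" for x
  proof -
    have "Re (J0.ipJ (R x) x) \<le> J0.J.nrm (R x) * J0.J.nrm x"
      using complex_Re_le_cmod J0.J.cmod_ip_le order_trans by blast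
    also have "\<dots> \<le> C * J0.J.nrm x * J0.J.nrm x" by (rule mult_right_mono[OF C(2)]) simp
    finally show ?thesis by (simp add: power2_eq_square)
  qed
  have half: "\<exists>t. \<forall>E. orthonormal_basis J.ipJ E \<longrightarrow>
      ((\<lambda>e. Re (J0.ipJ (R (Y e)) (Y e)) + s * Re (ip (W (Y e)) (Y e))) has_sum t) E"
    if "\<bar>s\<bar> = 1" for s :: real
  proof -
    define p where "p x y = J0.ipJ (R x) y + of_real s * ip (W x) y" for x y
    have sb: "\<bar>s * Re (ip (W x) x)\<bar> \<le> Re (J0.ipJ (R x) x)" for x
      using le[of x] ge[of x] that by (simp add: abs_mult)
    have p_Re: "Re (p x x) = Re (J0.ipJ (R x) x) + s * Re (ip (W x) x)" for x
      by (simp add: p_def)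
    have herm: "hermitian_space scl p"
    proof unfold_locales
      fix x y
      show "p x y = cnj (p y x)"
        using R_sym[of x y] q.ip_commute[of x y] by (simp add: p_def)
    qed (simp_all add: p_def R.add R.scale J0.J.ip_simps q.ip_simps algebra_simps)
    have pos: "0 \<le> Re (p x x)" and le2: "Re (p x x) \<le> 2 * Re (J0.ipJ (R x) x)" for x
      using sb[of x] by (auto simp: p_Re)
    have "\<exists>t. \<forall>E. orthonormal_basis J.ipJ E \<longrightarrow> ((\<lambda>e. Re (p (Y e) (Y e))) has_sum t) E"
    proof (rule positive_form_trace[OF J0.signature_space_axioms J sep herm pos _ E0 _ Y])
      show "Re (p x x) \<le> (2 * C) * (J0.J.nrm x)\<^sup>2" for x
        using le2[of x] R_C[of x] by simp
      show "(\<lambda>e. Re (p e e)) summable_on E0"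
        by (rule summable_on_comparison_test[OF tr_R]) (use pos le2 in auto)
    qed
    then show ?thesis by (simp add: p_Re)
  qed
  obtain t1 where t1: "\<And>E. orthonormal_basis J.ipJ E \<Longrightarrow>
      ((\<lambda>e. Re (J0.ipJ (R (Y e)) (Y e)) + Re (ip (W (Y e)) (Y e))) has_sum t1) E"
    using half[of 1] by auto
  obtain t2 where t2: "\<And>E. orthonormal_basis J.ipJ E \<Longrightarrow>
      ((\<lambda>e. Re (J0.ipJ (R (Y e)) (Y e)) - Re (ip (W (Y e)) (Y e))) has_sum t2) E"
    using half[of "-1"] by auto
  have "((\<lambda>e. Re (ip (W (Y e)) (Y e))) has_sum (1/2 * (t1 + - t2))) E"
    if E: "orthonormal_basis J.ipJ E" for E
  proof -
    have "((\<lambda>e. 1/2 * ((Re (J0.ipJ (R (Y e)) (Y e)) + Re (ip (W (Y e)) (Y e)))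
        + - (Re (J0.ipJ (R (Y e)) (Y e)) - Re (ip (W (Y e)) (Y e))))) has_sum (1/2 * (t1 + - t2))) E"
      by (intro has_sum_cmult_right has_sum_add has_sum_uminusI t1 t2 E)
    then show ?thesis by simp
  qed
  then show ?thesis by blast
qed

section \<open>Indefinite least squares problems\<close>

text \<open>Opposite multiples of \<open>v\<close> cancel the linear term of the expansion and leave
  \<open>ip v v\<close> nonnegative; a nonzero \<open>ip r v\<close> would let a small multiple of
  \<open>v\<close> lower the value.\<close>

lemma (in hermitian_space) least_squares_iff:
  assumes V: "subspace V"
  shows "(\<forall>v\<in>V. ip r r \<le> ip (r + v) (r + v)) \<longleftrightarrow> (\<forall>v\<in>V. 0 \<le> ip v v \<and> ip r v = 0)"
proof
  assume min: "\<forall>v\<in>V. ip r r \<le> ip (r + v) (r + v)"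
  show "\<forall>v\<in>V. 0 \<le> ip v v \<and> ip r v = 0"
  proof
    fix v assume v: "v \<in> V"
    define b where "b = Re (ip v v)"
    have *: "0 \<le> 2 * Re (cnj c * ip r v) + (cmod c)\<^sup>2 * b" for c
    proof -
      have "ip r r \<le> ip (r + scl c v) (r + scl c v)" using min V v by (simp add: subspace_scale)
      then have "Re (ip r r) \<le> Re (ip (r + scl c v) (r + scl c v))" by (simp add: less_eq_complex_def)
      then show ?thesis
        unfolding ip_self_add ip_self_scale unfolding ip_scale_right b_def by simp
    qed
    have b: "0 \<le> b" using *[of 1] *[of "-1"] by simp
    have "ip r v = 0"
    proof (rule ccontr)
      assume n: "ip r v \<noteq> 0"
      \<comment> \<open>With the multiplier \<open>- s * ip r v\<close> the value changes by at most
        \<open>s * w * (s * b - 2)\<close>; adding 1 to \<open>b\<close> keeps \<open>s * b\<close>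
        below 1 and covers \<open>b = 0\<close>.\<close>
      define s where "s = 1 / (b + 1)"
      define w where "w = (cmod (ip r v))\<^sup>2"
      have "w > 0" using n by (simp add: w_def)
      have "s > 0" "s * b < 1" using b by (simp_all add: s_def)
      have "cnj (- of_real s * ip r v) * ip r v = of_real (- s * w)"
        by (simp add: w_def complex_norm_square mult.commute del: of_real_power)
      moreover have "(cmod (- of_real s * ip r v))\<^sup>2 = s\<^sup>2 * w"
        using \<open>s > 0\<close> by (simp add: norm_mult w_def power_mult_distrib)
      ultimately have "0 \<le> 2 * (- s * w) + s\<^sup>2 * w * b"
        using *[of "- of_real s * ip r v"] by (simp only: Re_complex_of_real)
      also have "\<dots> = (s * w) * (s * b - 2)" by (simp add: algebra_simps power2_eq_square)
      also have "\<dots> < 0" using \<open>s > 0\<close> \<open>w > 0\<close> \<open>s * b < 1\<close> by (intro mult_pos_neg) auto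
      finally show False by simp
    qed
    then show "0 \<le> ip v v \<and> ip r v = 0" using b by (simp add: b_def less_eq_complex_def)
  qed
next
  assume *: "\<forall>v\<in>V. 0 \<le> ip v v \<and> ip r v = 0"
  show "\<forall>v\<in>V. ip r r \<le> ip (r + v) (r + v)"
  proof
    fix v assume "v \<in> V"
    then have "0 \<le> ip v v" "ip r v = 0" "ip v r = 0"
      using * ip_commute[of v r] by auto
    then show "ip r r \<le> ip (r + v) (r + v)" by (simp add: ip_simps)
  qed
qed

lemma range_linear_subspace:
  assumes "Vector_Spaces.linear s1 s2 T"
  shows "module.subspace s2 (range T)"
proof -
  interpret T: Vector_Spaces.linear s1 s2 T by fact
  show ?thesis by (intro T.subspace_image T.vs1.subspace_UNIV)
qed

text \<open>The vectors \<open>A z - x\<close> are the translates of \<open>A u - x\<close> by the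
  range of \<open>A\<close>, so the criterion applies to the form \<open>[W x, y]\<close>.\<close>

lemma W_ILSS_iff:
  assumes J: "signature_space sclH ip J" and W: "W \<in> krein_selfadjoint sclH ip"
    and A: "Vector_Spaces.linear sclK sclH A"
  shows "W_ILSS ip W A x u \<longleftrightarrow>
    W_nonnegative ip W (range A) \<and> (\<forall>z. ip (W (A u - x)) (A z) = 0)"
proof -
  interpret q: hermitian_space sclH "\<lambda>x y. ip (W x) y" by (rule selfadjoint_form_hermitian[OF J W])
  interpret A: Vector_Spaces.linear sclK sclH A by (rule A)
  have "W_ILSS ip W A x u \<longleftrightarrow>
      (\<forall>v\<in>range A. ip (W (A u - x)) (A u - x) \<le> ip (W (A u - x + v)) (A u - x + v))"
  proof
    assume L: "W_ILSS ip W A x u"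
    have eq: "A u - x + A z = A (u + z) - x" for z by (simp add: A.add)
    show "\<forall>v\<in>range A. ip (W (A u - x)) (A u - x) \<le> ip (W (A u - x + v)) (A u - x + v)"
      unfolding ball_simps eq using L unfolding W_ILSS_def by blast
  next
    assume R: "\<forall>v\<in>range A. ip (W (A u - x)) (A u - x) \<le> ip (W (A u - x + v)) (A u - x + v)"
    show "W_ILSS ip W A x u"
      unfolding W_ILSS_def
    proof
      fix z
      have "A u - x + A (z - u) = A z - x" by (simp add: A.diff)
      then show "ip (W (A u - x)) (A u - x) \<le> ip (W (A z - x)) (A z - x)"
        using R by (metis rangeI)
    qed
  qed
  also have "\<dots> \<longleftrightarrow> (\<forall>v\<in>range A. 0 \<le> ip (W v) v \<and> ip (W (A u - x)) v = 0)"
    by (rule q.least_squares_iff[OF range_linear_subspace[OF A]])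
  finally show ?thesis by (auto simp: W_nonnegative_def)
qed

section \<open>Bounded solution of the normal equations\<close>

text \<open>As \<open>m\<close> may lie in the closure of \<open>S\<close> only, it cannot be tested
  against itself; a nearby \<open>s\<close> takes its place.\<close>

lemma (in hilbert_space) nrm_le_of_ip_bound_near:
  assumes near: "\<And>e. e > 0 \<Longrightarrow> \<exists>s\<in>S. nrm (m - s) < e"
    and b: "\<And>s. s \<in> S \<Longrightarrow> cmod (g m s) \<le> B * nrm s" and B: "0 \<le> B"
  shows "nrm m \<le> B"
proof (rule ccontr)
  assume n: "\<not> nrm m \<le> B"
  define a where "a = nrm m"
  \<comment> \<open>Chosen such that \<open>(a + B) * e\<close> is half of
    \<open>a * (a - B)\<close>, the slack between \<open>a\<^sup>2\<close> and
    \<open>B * a\<close>.\<close>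
  define e where "e = a * (a - B) / 2 / (a + B)"
  have "a > B" "a > 0" using n B by (auto simp: a_def)
  then have "e > 0" using B by (simp add: e_def)
  then obtain s where s: "s \<in> S" "nrm (m - s) < e" using near by blast
  have "a\<^sup>2 = cmod (g m m)" by (simp add: a_def ip_self_nrm norm_power)
  also have "g m m = g m (m - s) + g m s" by (simp add: ip_simps)
  also have "cmod \<dots> \<le> a * nrm (m - s) + B * nrm s"
    unfolding a_def by (intro norm_triangle_le add_mono cmod_ip_le b s(1))
  also have "nrm s \<le> a + nrm (m - s)"
    using nrm_diff_le[of m "m - s"] by (simp add: a_def)
  then have "a * nrm (m - s) + B * nrm s \<le> B * a + (a + B) * nrm (m - s)"
    using mult_left_mono[OF _ B, of "nrm s" "a + nrm (m - s)"] by (simp add: algebra_simps)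
  also have "\<dots> < B * a + (a + B) * e"
    using s(2) \<open>a > 0\<close> B by simp
  also have "(a + B) * e = a * (a - B) / 2"
    unfolding e_def using \<open>a > 0\<close> B by (metis add_pos_nonneg less_irrefl nonzero_mult_div_cancel_left times_divide_eq_right)
  finally have "a * (a - B) < 0" by (simp add: power2_eq_square field_simps)
  then show False using \<open>a > B\<close> \<open>a > 0\<close> by (simp add: mult_less_0_iff)
qed

text \<open>If \<open>\<langle>u, M z\<rangle> = \<langle>x, N z\<rangle>\<close> is solvable in \<open>u\<close> for every \<open>x\<close>, then the solution in the closure of the
  range of \<open>M\<close> is unique, hence linear in \<open>x\<close>. For bounded \<open>M z\<close> the vectors \<open>N z\<close> are weakly bounded,
  so that \<open>N z\<close> is dominated by \<open>M z\<close>.\<close>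

theorem bounded_solution_operator:
  assumes H: "hilbert_space sclH g" and K: "hilbert_space sclK k"
    and M: "Vector_Spaces.linear sclK sclK M" and N: "\<And>c z. N (sclK c z) = sclH c (N z)"
    and solvable: "\<And>x. \<exists>u. \<forall>z. k u (M z) = g x (N z)"
  shows "\<exists>G. bounded_op sclH g sclK k G \<and> (\<forall>x z. k (G x) (M z) = g x (N z))"
proof -
  interpret H: hilbert_space sclH g by (rule H)
  interpret K: hilbert_space sclK k by (rule K)
  interpret M: Vector_Spaces.linear sclK sclK M by (rule M)
  have sub: "K.subspace (range M)" by (rule range_linear_subspace[OF M])
  \<comment> \<open>Projecting a solution onto the closure of the range of \<open>M\<close> keeps
    all its pairings with that range.\<close>
  have "\<exists>y. (\<forall>e>0. \<exists>s\<in>range M. K.nrm (y - s) < e) \<and> (\<forall>z. k y (M z) = g x (N z))" for x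
  proof -
    obtain u where u: "\<And>z. k u (M z) = g x (N z)" using solvable by blast
    obtain y where "\<forall>e>0. \<exists>s\<in>range M. K.nrm (y - s) < e" "\<forall>s\<in>range M. k (u - y) s = 0"
      using K.ex_projection[OF sub] by blast
    then show ?thesis using u by (intro exI[of _ y]) (auto simp: K.ip_diff_left)
  qed
  then obtain G where near: "\<And>x e. e > 0 \<Longrightarrow> \<exists>s\<in>range M. K.nrm (G x - s) < e"
    and G: "\<And>x z. k (G x) (M z) = g x (N z)" by metis
  \<comment> \<open>Uniqueness: a vector of the closure that is orthogonal to the range vanishes.
    Applied to defects of linearity, it makes \<open>G\<close> linear.\<close>
  have near0: "y = 0" if y: "\<And>e. e > 0 \<Longrightarrow> \<exists>s\<in>range M. K.nrm (y - s) < e" "\<And>z. k y (M z) = 0" for y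
  proof -
    have "K.nrm y \<le> 0" by (rule K.nrm_le_of_ip_bound_near[OF y(1)]) (use y(2) in auto)
    then show ?thesis using K.nrm_pos[of y] by (cases "y = 0") auto
  qed
  have near_add: "\<exists>s\<in>range M. K.nrm (x + y - s) < e"
    if x: "\<And>e. e > 0 \<Longrightarrow> \<exists>s\<in>range M. K.nrm (x - s) < e"
      and y: "\<And>e. e > 0 \<Longrightarrow> \<exists>s\<in>range M. K.nrm (y - s) < e" and "e > 0" for x y e
  proof -
    obtain a b where a: "a \<in> range M" "K.nrm (x - a) < e / 2"
      and b: "b \<in> range M" "K.nrm (y - b) < e / 2"
      using x[of "e / 2"] y[of "e / 2"] \<open>e > 0\<close> half_gt_zero by metis
    have eq: "x + y - (a + b) = (x - a) + (y - b)" by (simp add: algebra_simps)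
    have "K.nrm (x + y - (a + b)) < e"
      unfolding eq using K.nrm_triangle[of "x - a" "y - b"] a(2) b(2) by linarith
    then show ?thesis using K.subspace_add[OF sub a(1) b(1)] by blast
  qed
  have near_scale: "\<exists>s\<in>range M. K.nrm (sclK c x - s) < e"
    if x: "\<And>e. e > 0 \<Longrightarrow> \<exists>s\<in>range M. K.nrm (x - s) < e" and "e > 0" for c x e
  proof -
    have pos: "cmod c + 1 > 0" using norm_ge_zero[of c] by linarith
    then obtain a where a: "a \<in> range M" "K.nrm (x - a) < e / (cmod c + 1)"
      using x[of "e / (cmod c + 1)"] \<open>e > 0\<close> by auto
    have "K.nrm (sclK c x - sclK c a) = cmod c * K.nrm (x - a)"
      by (simp add: K.form_norm_scale flip: K.scale_right_diff_distrib)
    also have "\<dots> \<le> (cmod c + 1) * K.nrm (x - a)" by (simp add: mult_right_mono)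
    also have "\<dots> < e" using a(2) pos by (simp add: field_simps)
    finally show ?thesis using K.subspace_scale[OF sub a(1)] by blast
  qed
  have add: "G (x + y) = G x + G y" for x y
  proof -
    have "G (x + y) + (sclK (-1) (G x) + sclK (-1) (G y)) = 0"
      by (rule near0, intro near_add near_scale near; assumption?)
        (simp_all add: K.ip_simps G H.ip_simps)
    then show ?thesis by (simp add: algebra_simps)
  qed
  have scale: "G (sclH c x) = sclK c (G x)" for c x
  proof -
    have "G (sclH c x) + sclK (- c) (G x) = 0"
      by (rule near0, intro near_add near_scale near; assumption?)
        (simp_all add: K.ip_simps G H.ip_simps)
    then show ?thesis by simp
  qed
  have "\<exists>C. \<forall>y\<in>N ` {z. K.nrm (M z) \<le> 1}. H.nrm y \<le> C"
  proof (rule H.weakly_bounded_imp_bounded)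
    fix x
    have "cmod (g x (N z)) \<le> K.nrm (G x)" if "K.nrm (M z) \<le> 1" for z
    proof -
      have "cmod (g x (N z)) \<le> K.nrm (G x) * K.nrm (M z)"
        using K.cmod_ip_le[of "G x" "M z"] by (simp add: G)
      also have "\<dots> \<le> K.nrm (G x)" using that by (simp add: mult_left_le)
      finally show ?thesis .
    qed
    then show "\<exists>C. \<forall>y\<in>N ` {z. K.nrm (M z) \<le> 1}. cmod (g x y) \<le> C" by blast
  qed
  then obtain C where C: "\<And>z. K.nrm (M z) \<le> 1 \<Longrightarrow> H.nrm (N z) \<le> C" by blast
  have "0 \<le> C"
    using C[of 0] M.scale[of 0 0] order_trans[OF H.form_norm_nonneg] by simp
  have NM: "H.nrm (N z) \<le> C * K.nrm (M z)" for z
  proof (cases "M z = 0")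
    case True
    \<comment> \<open>If \<open>M z = 0\<close>, all multiples of \<open>z\<close> obey the
      constraint; unless \<open>N z\<close> vanishes, one of them has an image under
      \<open>N\<close> of norm \<open>C + 1\<close>.\<close>
    have "H.nrm (N z) \<le> 0"
    proof (rule ccontr)
      assume "\<not> ?thesis"
      then have pos: "H.nrm (N z) > 0" by simp
      have "H.nrm (N (sclK (of_real ((C + 1) / H.nrm (N z))) z)) \<le> C"
        by (rule C) (simp add: M.scale True)
      then show False using pos \<open>0 \<le> C\<close> unfolding N H.nrm_scale_real
        by (auto split: if_splits)
    qed
    then show ?thesis using True by simp
  next
    case False
    have "H.nrm (N (sclK (of_real (1 / K.nrm (M z))) z)) \<le> C"
      by (rule C) (simp only: M.scale K.nrm_normalize[OF False])
    then show ?thesis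
      using K.nrm_pos[OF False] unfolding N H.nrm_scale_real by (simp add: field_simps)
  qed
  have bound: "K.nrm (G x) \<le> C * H.nrm x" for x
  proof (rule K.nrm_le_of_ip_bound_near[OF near])
    fix s assume "s \<in> range M"
    then obtain z where z: "s = M z" by blast
    have "cmod (k (G x) s) \<le> H.nrm x * H.nrm (N z)" by (simp add: z G H.cmod_ip_le)
    also have "\<dots> \<le> H.nrm x * (C * K.nrm (M z))" by (intro mult_left_mono NM) simp
    finally show "cmod (k (G x) s) \<le> C * H.nrm x * K.nrm s" by (simp add: z mult_ac)
  qed (use \<open>0 \<le> C\<close> in auto)
  have "Vector_Spaces.linear sclH sclK G"
    by unfold_locales (simp_all add: add scale)
  then show ?thesis using bound G by (auto simp: bounded_op_def)
qed

lemma krein_operators_id: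
  assumes J: "signature_space scl ip J"
  shows "(\<lambda>x. x) \<in> krein_operators scl ip scl ip"
proof -
  interpret J: signature_space scl ip J by fact
  have "bounded_op scl J.ipJ scl J.ipJ (\<lambda>x. x)"
    unfolding bounded_op_def by (intro conjI exI[of _ 1]) (unfold_locales, auto)
  then show ?thesis using krein_operators_iff[OF J J] by blast
qed

lemma krein_operators_rank_one:
  assumes J: "signature_space sclH ipH J" and L: "signature_space sclK ipK L"
  shows "(\<lambda>h. sclK (signature_ip ipH J h e) z) \<in> krein_operators sclH ipH sclK ipK"
proof -
  interpret J: signature_space sclH ipH J by fact
  interpret L: signature_space sclK ipK L by fact
  have "Vector_Spaces.linear sclH sclK (\<lambda>h. sclK (J.ipJ h e) z)"
    by unfold_locales (simp_all add: J.J.ip_simps L.scale_left_distrib)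
  moreover have "L.J.nrm (sclK (J.ipJ h e) z) \<le> (J.J.nrm e * L.J.nrm z) * J.J.nrm h" for h
    using mult_right_mono[OF J.J.cmod_ip_le[of h e], of "L.J.nrm z"]
    by (simp add: L.J.form_norm_scale mult_ac)
  ultimately have "bounded_op sclH J.ipJ sclK L.ipJ (\<lambda>h. sclK (J.ipJ h e) z)"
    by (auto simp: bounded_op_def)
  then show ?thesis using krein_operators_iff[OF J L] by blast
qed

text \<open>In the signature inner products \<open>M\<close> is \<open>L A# W A\<close> and
  \<open>N z\<close> is \<open>J (W (A z))\<close>, by self-adjointness of \<open>W\<close>; the
  normal equations then take the shape of \<open>bounded_solution_operator\<close>.\<close>

lemma ex_bounded_W_inverse:
  assumes J: "signature_space sclH ipH J" and L: "signature_space sclK ipK L"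
    and A: "A \<in> krein_operators sclK ipK sclH ipH" and W: "W \<in> krein_selfadjoint sclH ipH"
    and ilss: "\<And>x. \<exists>u. W_ILSS ipH W A x u"
  shows "\<exists>G. indefinite_W_inverse sclK ipK sclH ipH W A G"
proof -
  interpret J: signature_space sclH ipH J by fact
  interpret L: signature_space sclK ipK L by fact
  note Wsym = krein_selfadjointD(2)[OF J W] and W' = krein_selfadjointD(1)[OF J W]
  have A_lin: "Vector_Spaces.linear sclK sclH A"
    using A krein_operators_iff[OF L J] by (simp add: bounded_op_def)
  have W_lin: "Vector_Spaces.linear sclH sclH W"
    using W' krein_operators_iff[OF J J] by (simp add: bounded_op_def)
  interpret A: Vector_Spaces.linear sclK sclH A by (rule A_lin)
  interpret W: Vector_Spaces.linear sclH sclH W by (rule W_lin)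
  interpret JL: Vector_Spaces.linear sclH sclH J by (rule J.J_linear)
  note iff = W_ILSS_iff[OF J W A_lin]
  have nonneg: "W_nonnegative ipH W (range A)" using ilss iff by blast
  have "(\<lambda>z. W (A z)) \<in> krein_operators sclK ipK sclH ipH"
    by (rule krein_operators_compose[OF L J J A W'])
  then have "bounded_op sclK L.ipJ sclH J.ipJ (\<lambda>z. W (A z))"
    using krein_operators_iff[OF L J] by blast
  then obtain C where C: "\<And>z. J.J.nrm (W (A z)) \<le> C * L.J.nrm z"
    by (auto simp: bounded_op_def)
  have "\<exists>m. \<forall>z. ipH (W (A z)) (A y) = L.ipJ z m" for y
  proof (rule L.J.Riesz)
    show "functional sclK (\<lambda>z. ipH (W (A z)) (A y))"
      by (simp add: functional_def A.add A.scale W.add W.scale J.ip_simps)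
    show "cmod (ipH (W (A z)) (A y)) \<le> (C * J.J.nrm (A y)) * L.J.nrm z" for z
      using J.cmod_ip_le_nrm[of "W (A z)" "A y"] mult_right_mono[OF C[of z], of "J.J.nrm (A y)"]
      by (simp add: mult_ac)
  qed
  then obtain M where M: "\<And>z y. ipH (W (A z)) (A y) = L.ipJ z (M y)" by metis
  have "M (x + y) = M x + M y" "M (sclK c x) = sclK c (M x)" for x y c
    by (rule L.J.ip_right_eqI,
        simp add: L.J.ip_simps M[symmetric] A.add A.scale J.ip_simps)+
  then have M_lin: "Vector_Spaces.linear sclK sclK M" by unfold_locales
  have N: "J.ipJ x (J (W (A z))) = ipH (W x) (A z)" for x z
    by (simp add: Wsym flip: J.ip_eq_ipJ)
  have "\<exists>G. bounded_op sclH J.ipJ sclK L.ipJ G \<and>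
      (\<forall>x z. L.ipJ (G x) (M z) = J.ipJ x (J (W (A z))))"
  proof (rule bounded_solution_operator[OF J.J.hilbert_space_axioms L.J.hilbert_space_axioms M_lin])
    fix x
    obtain u where "W_ILSS ipH W A x u" using ilss by blast
    then have "\<forall>z. ipH (W (A u - x)) (A z) = 0" using iff by blast
    then have "\<forall>z. L.ipJ u (M z) = J.ipJ x (J (W (A z)))"
      by (simp add: N M[symmetric] W.diff J.ip_diff_left)
    then show "\<exists>u. \<forall>z. L.ipJ u (M z) = J.ipJ x (J (W (A z)))" by blast
  qed (simp add: A.scale W.scale JL.scale)
  then obtain G where G: "bounded_op sclH J.ipJ sclK L.ipJ G"
    "\<And>x z. ipH (W (A (G x))) (A z) = ipH (W x) (A z)"
    by (auto simp: N M[symmetric])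
  have "W_ILSS ipH W A x (G x)" for x
    unfolding iff using nonneg G(2) by (simp add: W.diff J.ip_diff_left)
  then show ?thesis
    using G(1) krein_operators_iff[OF J L] by (auto simp: indefinite_W_inverse_def)
qed

section \<open>The least squares problem for the trace\<close>

text \<open>For the residual \<open>Y\<close> the diagonal entries \<open>[Y# W Y e, e]\<close>
  equal \<open>[W Y e, Y e]\<close>, so the trace exists and is real. Hence any two traces are
  comparable in the complex order.\<close>

lemma J_trace_residual:
  assumes J: "signature_space sclH ipH J" and L: "signature_space sclK ipK L"
    and sep: "krein_separable sclH ipH"
    and A: "A \<in> krein_operators sclK ipK sclH ipH"
    and tc: "W \<in> krein_trace_class sclH ipH" and W: "W \<in> krein_selfadjoint sclH ipH"
    and X: "X \<in> krein_operators sclH ipH sclK ipK"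
  obtains t where "J_trace ipH J (residual_operator ipH W A X) = of_real t"
    and "\<And>E. orthonormal_basis (signature_ip ipH J) E \<Longrightarrow>
      ((\<lambda>e. Re (ipH (W (A (X e) - e)) (A (X e) - e))) has_sum t) E"
proof -
  interpret J: signature_space sclH ipH J by fact
  interpret q: hermitian_space sclH "\<lambda>x y. ipH (W x) y" by (rule selfadjoint_form_hermitian[OF J W])
  define Y where "Y e = A (X e) - e" for e
  have Y: "Y \<in> krein_operators sclH ipH sclH ipH"
    unfolding Y_def[abs_def]
    by (intro krein_operators_diff[OF J J] krein_operators_compose[OF J L J X A]
        krein_operators_id[OF J])
  obtain t where t: "\<And>E. orthonormal_basis J.ipJ E \<Longrightarrow>
      ((\<lambda>e. Re (ipH (W (Y e)) (Y e))) has_sum t) E"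
    using trace_class_form_trace[OF J sep tc W Y] by blast
  have res: "ipH (residual_operator ipH W A X e) e = of_real (Re (ipH (W (Y e)) (Y e)))" for e
  proof -
    have "residual_operator ipH W A X e = form_adjoint ipH ipH Y (W (Y e))"
      by (simp add: residual_operator_def Y_def[abs_def])
    then have "ipH (residual_operator ipH W A X e) e = cnj (ipH (Y e) (W (Y e)))"
      by (metis J.ip_commute J.ip_krein_adjoint[OF Y])
    also have "\<dots> = ipH (W (Y e)) (Y e)" by (rule J.ip_commute[symmetric])
    finally show ?thesis using q.ip_self by simp
  qed
  have sum: "((\<lambda>e. ipH (residual_operator ipH W A X e) e) has_sum of_real t) E"
    if "orthonormal_basis J.ipJ E" for E
    unfolding res using t[OF that] by (rule has_sum_of_real)
  obtain E0 where E0: "orthonormal_basis J.ipJ E0" using J.J.ex_orthonormal_basis by blast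
  have "J_trace ipH J (residual_operator ipH W A X) = of_real t"
    unfolding J_trace_def
  proof (rule the_equality)
    show "s = of_real t"
      if "\<forall>E. orthonormal_basis J.ipJ E \<longrightarrow>
        ((\<lambda>e. ipH (residual_operator ipH W A X e) e) has_sum s) E" for s
      using that sum[OF E0] E0 has_sum_unique by blast
  qed (use sum in blast)
  then show ?thesis using t by (intro that) (simp_all add: Y_def)
qed

lemma W_inverse_minimizes_J_trace:
  assumes J: "signature_space sclH ipH J" and L: "signature_space sclK ipK L"
    and sep: "krein_separable sclH ipH"
    and A: "A \<in> krein_operators sclK ipK sclH ipH"
    and tc: "W \<in> krein_trace_class sclH ipH" and W: "W \<in> krein_selfadjoint sclH ipH"
    and G: "indefinite_W_inverse sclK ipK sclH ipH W A G"
    and X: "X \<in> krein_operators sclH ipH sclK ipK"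
  shows "J_trace ipH J (residual_operator ipH W A G) \<le> J_trace ipH J (residual_operator ipH W A X)"
proof -
  interpret J: signature_space sclH ipH J by fact
  have G': "G \<in> krein_operators sclH ipH sclK ipK" and opt: "\<And>x. W_ILSS ipH W A x (G x)"
    using G by (auto simp: indefinite_W_inverse_def)
  obtain s where s: "J_trace ipH J (residual_operator ipH W A G) = of_real s"
    "\<And>E. orthonormal_basis J.ipJ E \<Longrightarrow>
      ((\<lambda>e. Re (ipH (W (A (G e) - e)) (A (G e) - e))) has_sum s) E"
    using J_trace_residual[OF J L sep A tc W G'] by blast
  obtain t where t: "J_trace ipH J (residual_operator ipH W A X) = of_real t"
    "\<And>E. orthonormal_basis J.ipJ E \<Longrightarrow>
      ((\<lambda>e. Re (ipH (W (A (X e) - e)) (A (X e) - e))) has_sum t) E"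
    using J_trace_residual[OF J L sep A tc W X] by blast
  obtain E where E: "orthonormal_basis J.ipJ E" using J.J.ex_orthonormal_basis by blast
  have "s \<le> t"
  proof (rule has_sum_mono[OF s(2)[OF E] t(2)[OF E]])
    show "Re (ipH (W (A (G e) - e)) (A (G e) - e)) \<le> Re (ipH (W (A (X e) - e)) (A (X e) - e))" for e
      using opt[of e] by (simp add: W_ILSS_def less_eq_complex_def)
  qed
  then show ?thesis by (simp add: s(1) t(1) less_eq_complex_def)
qed

text \<open>Perturbing a minimizer \<open>X0\<close> by the rank one operator \<open>\<langle>_, e\<rangle> z\<close> with \<open>e\<close> in an orthonormal basis
  \<open>E\<close> only changes the term of the trace at \<open>e\<close>, so that \<open>X0 e\<close> solves the least squares problem for
  \<open>e\<close>. The normal equations then hold on \<open>E\<close>, hence everywhere.\<close>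

lemma J_trace_minimizer_is_W_inverse:
  assumes J: "signature_space sclH ipH J" and L: "signature_space sclK ipK L"
    and sep: "krein_separable sclH ipH"
    and A: "A \<in> krein_operators sclK ipK sclH ipH"
    and tc: "W \<in> krein_trace_class sclH ipH" and W: "W \<in> krein_selfadjoint sclH ipH"
    and nonneg: "W_nonnegative ipH W (range A)"
    and X0: "X0 \<in> krein_operators sclH ipH sclK ipK"
    and min: "\<And>X. X \<in> krein_operators sclH ipH sclK ipK \<Longrightarrow>
      J_trace ipH J (residual_operator ipH W A X0) \<le> J_trace ipH J (residual_operator ipH W A X)"
  shows "indefinite_W_inverse sclK ipK sclH ipH W A X0"
proof -
  interpret J: signature_space sclH ipH J by fact
  interpret L: signature_space sclK ipK L by fact
  interpret q: hermitian_space sclH "\<lambda>x y. ipH (W x) y" by (rule selfadjoint_form_hermitian[OF J W])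
  note W' = krein_selfadjointD(1)[OF J W]
  have A_lin: "Vector_Spaces.linear sclK sclH A"
    using A krein_operators_iff[OF L J] by (simp add: bounded_op_def)
  interpret A: Vector_Spaces.linear sclK sclH A by (rule A_lin)
  obtain E where E: "orthonormal_basis J.ipJ E" using J.J.ex_orthonormal_basis by blast
  have on: "\<forall>e\<in>E. \<forall>f\<in>E. J.ipJ e f = (if e = f then 1 else 0)"
    using E by (simp add: orthonormal_basis_def)
  define Y where "Y x = A (X0 x) - x" for x
  have local_min: "Re (ipH (W (Y e)) (Y e)) \<le> Re (ipH (W (Y e + A z)) (Y e + A z))"
    if e: "e \<in> E" for e z
  proof -
    \<comment> \<open>Subtracting the operator built from \<open>- z\<close> adds the one built from
      \<open>z\<close>, so closure under differences applies.\<close>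
    define X where "X h = X0 h - sclK (J.ipJ h e) (- z)" for h
    have X: "X \<in> krein_operators sclH ipH sclK ipK"
      unfolding X_def[abs_def]
      by (rule krein_operators_diff[OF J L X0 krein_operators_rank_one[OF J L]])
    obtain s where s: "J_trace ipH J (residual_operator ipH W A X0) = of_real s"
      "((\<lambda>h. Re (ipH (W (A (X0 h) - h)) (A (X0 h) - h))) has_sum s) E"
      using J_trace_residual[OF J L sep A tc W X0] E by blast
    obtain t where t: "J_trace ipH J (residual_operator ipH W A X) = of_real t"
      "((\<lambda>h. Re (ipH (W (A (X h) - h)) (A (X h) - h))) has_sum t) E"
      using J_trace_residual[OF J L sep A tc W X] E by blast
    define f where "f h = Re (ipH (W (A (X h) - h)) (A (X h) - h))
      + - Re (ipH (W (A (X0 h) - h)) (A (X0 h) - h))" for h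
    have "(f has_sum (t + - s)) E"
      unfolding f_def by (intro has_sum_add has_sum_uminusI s t)
    moreover have "(f has_sum f e) E"
    proof (rule has_sum_finite_neutralI[of "{e}"])
      show "f h = 0" if "h \<in> E - {e}" for h
        using that bspec[OF bspec[OF on, of h] e] by (simp add: f_def X_def)
    qed (use e in auto)
    ultimately have "t - s = f e" using has_sum_unique by fastforce
    moreover have "s \<le> t" using min[OF X] by (simp add: s(1) t(1) less_eq_complex_def)
    moreover have "A (X e) - e = Y e + A z"
      using bspec[OF bspec[OF on e] e] by (simp add: X_def Y_def A.add)
    ultimately show ?thesis by (simp add: f_def Y_def)
  qed
  have on_E: "ipH (W (Y e)) (A z) = 0" if e: "e \<in> E" for e z
  proof -
    have "\<forall>v\<in>range A. ipH (W (Y e)) (Y e) \<le> ipH (W (Y e + v)) (Y e + v)"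
      using local_min[OF e] by (auto simp: less_eq_complex_def)
    then show ?thesis
      using q.least_squares_iff[OF range_linear_subspace[OF A_lin]] by blast
  qed
  have "Y \<in> krein_operators sclH ipH sclH ipH"
    unfolding Y_def[abs_def]
    by (intro krein_operators_diff[OF J J] krein_operators_compose[OF J L J X0 A]
        krein_operators_id[OF J])
  from krein_operators_compose[OF J J J this W'] have WY': "bounded_op sclH J.ipJ sclH J.ipJ (\<lambda>x. W (Y x))"
    using krein_operators_iff[OF J J] by blast
  have "ipH (W (Y x)) (A z) = 0" for x z
  proof -
    \<comment> \<open>Passing from \<open>E\<close> to all \<open>x\<close> uses boundedness: the
      normal equation at \<open>x\<close> is a pairing with a fixed vector \<open>v\<close>, which
      is orthogonal to \<open>E\<close>.\<close>
    define v where "v = form_adjoint J.ipJ J.ipJ (\<lambda>x. W (Y x)) (J (A z))"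
    have v: "ipH (W (Y x)) (A z) = J.ipJ x v" for x
      unfolding v_def J.ip_eq_ipJ[of "W (Y x)"] by (rule J.J.ip_form_adjoint[OF WY'])
    have "J.ipJ v e = 0" if "e \<in> E" for e
      using on_E[OF that, of z] J.J.ip_commute[of v e] unfolding v by simp
    then have "v = 0" using E unfolding orthonormal_basis_def by blast
    then show ?thesis unfolding v by simp
  qed
  then have "W_ILSS ipH W A x (X0 x)" for x
    unfolding W_ILSS_iff[OF J W A_lin] using nonneg by (simp add: Y_def)
  then show ?thesis using X0 by (simp add: indefinite_W_inverse_def)
qed

theorem corollary3p5:
  fixes sclH :: "complex \<Rightarrow> 'h::ab_group_add \<Rightarrow> 'h" and ipH :: "'h \<Rightarrow> 'h \<Rightarrow> complex"
    and sclK :: "complex \<Rightarrow> 'k::ab_group_add \<Rightarrow> 'k" and ipK :: "'k \<Rightarrow> 'k \<Rightarrow> complex"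
    and A :: "'k \<Rightarrow> 'h" and W :: "'h \<Rightarrow> 'h"
  assumes "krein_space sclH ipH" and "krein_separable sclH ipH"
    and "krein_space sclK ipK" and "krein_separable sclK ipK"
    and "A \<in> krein_operators sclK ipK sclH ipH"
    and "W \<in> krein_trace_class sclH ipH \<inter> krein_selfadjoint sclH ipH"
  shows "((\<forall>x. \<exists>u. W_ILSS ipH W A x u) \<longleftrightarrow>
          (\<exists>G. indefinite_W_inverse sclK ipK sclH ipH W A G)) \<and>
         ((\<exists>G. indefinite_W_inverse sclK ipK sclH ipH W A G) \<longleftrightarrow>
          (W_nonnegative ipH W (range A) \<and>
           (\<forall>J. signature_operator sclH ipH J \<longrightarrow>
             (\<exists>X0\<in>krein_operators sclH ipH sclK ipK.
               \<forall>X\<in>krein_operators sclH ipH sclK ipK.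
                 J_trace ipH J (residual_operator ipH W A X0)
                   \<le> J_trace ipH J (residual_operator ipH W A X)))))"
proof -
  have krein: "hermitian_space sclH ipH" "hermitian_space sclK ipK"
    using assms by (simp_all add: krein_space_def)
  obtain J where "signature_operator sclH ipH J" using ex_signature_operator[OF assms(1)] by blast
  then have J: "signature_space sclH ipH J"
    using krein by (simp add: signature_space_def signature_space_axioms_def)
  obtain L where "signature_operator sclK ipK L" using ex_signature_operator[OF assms(3)] by blast
  then have L: "signature_space sclK ipK L"
    using krein by (simp add: signature_space_def signature_space_axioms_def)
  note sep = assms(2) and A = assms(5)
  have tc: "W \<in> krein_trace_class sclH ipH" and W: "W \<in> krein_selfadjoint sclH ipH"
    using assms(6) by simp_all
  let ?i = "\<forall>x. \<exists>u. W_ILSS ipH W A x u"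
  let ?ii = "\<exists>G. indefinite_W_inverse sclK ipK sclH ipH W A G"
  let ?min = "\<lambda>J. \<exists>X0\<in>krein_operators sclH ipH sclK ipK.
    \<forall>X\<in>krein_operators sclH ipH sclK ipK.
      J_trace ipH J (residual_operator ipH W A X0) \<le> J_trace ipH J (residual_operator ipH W A X)"
  let ?iii = "W_nonnegative ipH W (range A) \<and> (\<forall>J. signature_operator sclH ipH J \<longrightarrow> ?min J)"
  have "?i \<longleftrightarrow> ?ii"
  proof
    assume ?i
    then show ?ii using ex_bounded_W_inverse[OF J L A W] by blast
  qed (auto simp: indefinite_W_inverse_def)
  moreover have "?ii \<longleftrightarrow> ?iii"
  proof
    assume ?ii
    then obtain G where G: "indefinite_W_inverse sclK ipK sclH ipH W A G" by blast
    have "Vector_Spaces.linear sclK sclH A"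
      using A krein_operators_iff[OF L J] by (simp add: bounded_op_def)
    then have "W_nonnegative ipH W (range A)"
      using G W_ILSS_iff[OF J W]
      unfolding indefinite_W_inverse_def by blast
    moreover have "?min J'" if "signature_operator sclH ipH J'" for J'
    proof (intro bexI[of _ G] ballI)
      have "signature_space sclH ipH J'"
        using that krein by (simp add: signature_space_def signature_space_axioms_def)
      then show "J_trace ipH J' (residual_operator ipH W A G) \<le>
          J_trace ipH J' (residual_operator ipH W A X)"
        if "X \<in> krein_operators sclH ipH sclK ipK" for X
        using W_inverse_minimizes_J_trace[OF _ L sep A tc W G that] by blast
    qed (use G in \<open>simp add: indefinite_W_inverse_def\<close>)
    ultimately show ?iii by blast
  next
    assume iii: ?iii
    with \<open>signature_operator sclH ipH J\<close> obtain X0 where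
      X0: "X0 \<in> krein_operators sclH ipH sclK ipK" and
      min: "\<And>X. X \<in> krein_operators sclH ipH sclK ipK \<Longrightarrow>
        J_trace ipH J (residual_operator ipH W A X0) \<le> J_trace ipH J (residual_operator ipH W A X)"
      by blast
    have "indefinite_W_inverse sclK ipK sclH ipH W A X0"
      using iii by (intro J_trace_minimizer_is_W_inverse[OF J L sep A tc W _ X0 min]) blast
    then show ?ii by blast
  qed
  ultimately show ?thesis by blast
qed

end
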